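(* Let $\Bbbk$ be a field of characteristic $2$, $R=\Bbbk[z_{i,j}:1\le i,j\le3]$ with the standard grading, and let $I\subset R$ be the ideal generated by all $2\times2$ minors of the generic $3\times3$ matrix $(z_{i,j})$. Let $O_1,O_2,O_3$ be the orbits defined in the context, let $S\subset O_3$ be a subset of odd cardinality, and set $$H_{0,S}=\sum_{u\in O_1}u+\sum_{u\in O_2}u+\sum_{u\in S}u.$$ Consider the minimal graded free resolution of $R/I$ as an $R$-module $$F_\bullet:\quad0\to R(-6)\to R(-4)^9\to R(-3)^{16}\to R(-2)^9\to R$$ and its second Frobenius power $$\varphi^*F_\bullet:\quad0\to R(-12)\to R(-8)^9\to R(-6)^{16}\to R(-4)^9\to R.$$ Then there exists a chain map $\Phi^\flat_\bullet\colon\varphi^*F_\bullet\to F_\bullet$ such that $\Phi_0^\flat$ is the identity map and $\Phi_4^\flat\colon\varphi^*F_4\cong R(-12)\to R(-6)\cong F_4$ is multiplication by $H_{0,S}$.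
   Context: The group $G=\mathfrak{S}_3\times\mathfrak{S}_3$ acts on $R$ by $\Bbbk$-algebra automorphisms $(\sigma,\tau)\cdot z_{i,j}=z_{\sigma(i),\tau(j)}$. $O_1,O_2,O_3$ are the $G$-orbits of $$\eta_1=z_{1,2}z_{1,3}z_{2,2}z_{2,3}z_{3,1}^2,\quad\eta_2=z_{1,2}z_{1,3}z_{2,1}z_{2,3}z_{3,1}z_{3,2},\quad\eta_3=z_{1,2}^2z_{2,3}^2z_{3,1}^2,$$ respectively; they have $9$, $6$, $6$ elements. The second Frobenius power $\varphi^*F_\bullet$ is obtained from $F_\bullet$ by squaring all entries of the matrices of the differentials; the identifications of $F_4$ and $\varphi^*F_4$ with shifts of $R$ use a basis of $F_4$ and the induced basis of $\varphi^*F_4$. *)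

theory Defs
  imports "HOL-Analysis.Finite_Cartesian_Product" "HOL-Library.Poly_Mapping"
    "HOL-Library.Numeral_Type" "HOL-Computational_Algebra.Computational_Algebra"
begin

text \<open>
  Rows and columns are indexed by the three-element type \<open>3\<close>. Its elements are the
  numerals \<open>1\<close>, \<open>2\<close>, \<open>3\<close> (arithmetic is modulo three, so \<open>3 = 0\<close> there, which is harmless:
  \<open>1\<close>, \<open>2\<close>, \<open>3\<close> are still pairwise different and exhaust the type).
  A polynomial maps exponent vectors to coefficients; its ring structure is that of
  \<open>HOL-Library.Poly_Mapping\<close> (convolution product).
\<close>

type_synonym monom33 = "(3 \<times> 3) \<Rightarrow>\<^sub>0 nat"
type_synonym 'k poly33 = "monom33 \<Rightarrow>\<^sub>0 'k"

definition z :: "3 \<Rightarrow> 3 \<Rightarrow> 'k::field poly33" where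
  "z i j = Poly_Mapping.single (Poly_Mapping.single (i, j) 1) 1"

definition const :: "'k \<Rightarrow> 'k::field poly33" where
  "const c = Poly_Mapping.single 0 c"

definition mdeg :: "monom33 \<Rightarrow> nat" where
  "mdeg t = (\<Sum>v\<in>UNIV. Poly_Mapping.lookup t v)"

definition ideal_gen :: "'a::comm_ring_1 set \<Rightarrow> 'a set" where
  "ideal_gen B = module.span (*) B"

definition irrelevant_ideal :: "'k::field poly33 set" where
  "irrelevant_ideal = ideal_gen {z i j | i j. True}"

definition minors_ideal :: "'k::field poly33 set" where
  "minors_ideal =
     ideal_gen {z i j * z k l - z i l * z k j | i j k l. i \<noteq> k \<and> j \<noteq> l}"

text \<open>The \<open>'k\<close>-algebra endomorphism sending the variable with index \<open>v\<close> to \<open>f v\<close>.\<close>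

definition subst :: "(3 \<times> 3 \<Rightarrow> 'k poly33) \<Rightarrow> 'k poly33 \<Rightarrow> 'k::field poly33" where
  "subst f p = (\<Sum>t\<in>Poly_Mapping.keys p. const (Poly_Mapping.lookup p t) *
                  (\<Prod>v\<in>UNIV. f v ^ Poly_Mapping.lookup t v))"

definition act :: "(3 \<Rightarrow> 3) \<Rightarrow> (3 \<Rightarrow> 3) \<Rightarrow> 'k poly33 \<Rightarrow> 'k::field poly33" where
  "act \<sigma> \<tau> = subst (\<lambda>(i, j). z (\<sigma> i) (\<tau> j))"

definition orbit :: "'k poly33 \<Rightarrow> 'k::field poly33 set" where
  "orbit p = {act \<sigma> \<tau> p | \<sigma> \<tau>. bij \<sigma> \<and> bij \<tau>}"

definition eta1 :: "'k::field poly33" where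
  "eta1 = z 1 2 * z 1 3 * z 2 2 * z 2 3 * (z 3 1)\<^sup>2"

definition eta2 :: "'k::field poly33" where
  "eta2 = z 1 2 * z 1 3 * z 2 1 * z 2 3 * z 3 1 * z 3 2"

definition eta3 :: "'k::field poly33" where
  "eta3 = (z 1 2)\<^sup>2 * (z 2 3)\<^sup>2 * (z 3 1)\<^sup>2"

definition H0 :: "'k::field poly33 set \<Rightarrow> 'k poly33" where
  "H0 S = (\<Sum>u\<in>orbit eta1. u) + (\<Sum>u\<in>orbit eta2. u) + (\<Sum>u\<in>S. u)"

text \<open>
  A matrix \<open>A\<close> with \<open>'r\<close> rows and \<open>'c\<close> columns is the map \<open>(*v) A\<close> of free modules.
  \<open>graded_map n m A\<close> says that it is a homomorphism of graded modules (of degree \<open>0\<close>)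
  from \<open>R(-n)\<close> to the power \<open>'c\<close> to \<open>R(-m)\<close> to the power \<open>'r\<close>: every entry is
  homogeneous of degree \<open>n - m\<close> (in particular zero if \<open>n < m\<close>).
\<close>

definition graded_map :: "nat \<Rightarrow> nat \<Rightarrow> 'k::field poly33 ^ 'c ^ 'r \<Rightarrow> bool" where
  "graded_map n m A \<longleftrightarrow> (\<forall>i j. \<forall>t\<in>Poly_Mapping.keys (A $ i $ j). mdeg t + m = n)"

definition exact_at :: "'a::comm_ring_1 ^ 'p ^ 'n \<Rightarrow> 'a ^ 'n ^ 'm \<Rightarrow> bool" where
  "exact_at A B \<longleftrightarrow> range ((*v) A) = {x. B *v x = 0}"

definition minimal_map :: "'k::field poly33 ^ 'c ^ 'r \<Rightarrow> bool" where
  "minimal_map A \<longleftrightarrow> (\<forall>i j. A $ i $ j \<in> irrelevant_ideal)"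

text \<open>
  \<open>minimal_graded_free_resolution I a1 a2 a3 a4 d1 d2 d3 d4\<close>: the matrices \<open>d1, \<dots>, d4\<close> are
  the differentials, with respect to homogeneous bases, of a minimal graded free resolution
  of \<open>R/I\<close> whose \<open>i\<close>-th module is a direct sum of copies of \<open>R(-ai)\<close>, the number of copies
  being the size of the index type, and whose module in degree \<open>0\<close> is \<open>R\<close> itself, with
  the canonical projection \<open>R \<rightarrow> R/I\<close> as augmentation (so exactness there says that the image of
  \<open>d1\<close> is \<open>I\<close>).
\<close>

definition minimal_graded_free_resolution ::
  "'k::field poly33 set \<Rightarrow> nat \<Rightarrow> nat \<Rightarrow> nat \<Rightarrow> nat \<Rightarrow>
   'k poly33 ^ 'n1 ^ 1 \<Rightarrow> 'k poly33 ^ 'n2 ^ 'n1 \<Rightarrow> 'k poly33 ^ 'n3 ^ 'n2 \<Rightarrow>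
   'k poly33 ^ 'n4 ^ 'n3 \<Rightarrow> bool" where
  "minimal_graded_free_resolution I a1 a2 a3 a4 d1 d2 d3 d4 \<longleftrightarrow>
     graded_map a1 0 d1 \<and> graded_map a2 a1 d2 \<and> graded_map a3 a2 d3 \<and> graded_map a4 a3 d4 \<and>
     range ((*v) d1) = {x. x $ 1 \<in> I} \<and>
     exact_at d2 d1 \<and> exact_at d3 d2 \<and> exact_at d4 d3 \<and> inj ((*v) d4) \<and>
     minimal_map d1 \<and> minimal_map d2 \<and> minimal_map d3 \<and> minimal_map d4"

definition frob_mat :: "'a::comm_ring_1 ^ 'c ^ 'r \<Rightarrow> 'a ^ 'c ^ 'r" where
  "frob_mat A = (\<chi> i j. (A $ i $ j)\<^sup>2)"

definition chain_map ::
  "'a::comm_ring_1 ^ 'm1 ^ 'm0 \<Rightarrow> 'a ^ 'm2 ^ 'm1 \<Rightarrow> 'a ^ 'm3 ^ 'm2 \<Rightarrow> 'a ^ 'm4 ^ 'm3 \<Rightarrow>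
   'a ^ 'n1 ^ 'n0 \<Rightarrow> 'a ^ 'n2 ^ 'n1 \<Rightarrow> 'a ^ 'n3 ^ 'n2 \<Rightarrow> 'a ^ 'n4 ^ 'n3 \<Rightarrow>
   'a ^ 'm0 ^ 'n0 \<Rightarrow> 'a ^ 'm1 ^ 'n1 \<Rightarrow> 'a ^ 'm2 ^ 'n2 \<Rightarrow> 'a ^ 'm3 ^ 'n3 \<Rightarrow>
   'a ^ 'm4 ^ 'n4 \<Rightarrow> bool" where
  "chain_map c1 c2 c3 c4 d1 d2 d3 d4 P0 P1 P2 P3 P4 \<longleftrightarrow>
     P0 ** c1 = d1 ** P1 \<and> P1 ** c2 = d2 ** P2 \<and> P2 ** c3 = d3 ** P3 \<and> P3 ** c4 = d4 ** P4"

definition is_basis :: "('a::comm_ring_1 ^ 'n) set \<Rightarrow> bool" where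
  "is_basis B \<longleftrightarrow> \<not> module.dependent (*s) B \<and> module.span (*s) B = UNIV"

text \<open>
  The element \<open>1 \<otimes> b\<close> of the Frobenius power of a free module induced by an element \<open>b\<close> of
  the module: if \<open>b\<close> has coordinates \<open>r\<^sub>i\<close>, then \<open>1 \<otimes> b\<close> has coordinates \<open>r\<^sub>i\<^sup>2\<close> with respect to
  the induced basis. Replacing a basis element \<open>b\<close> of a module of rank one by \<open>c b\<close>, with \<open>c\<close>
  a unit, therefore replaces the induced basis element by its multiple with \<open>c\<^sup>2\<close>.
\<close>

definition frob_vec :: "'a::comm_ring_1 ^ 'n \<Rightarrow> 'a ^ 'n" where
  "frob_vec b = (\<chi> i. (b $ i)\<^sup>2)"

end

theory Submission
  imports Defs "HOL-Analysis.Cartesian_Space"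
begin

text \<open>
  Write \<open>I\<close> for the ideal of minors, \<open>J\<close> for its Frobenius power, generated by the squares of the minors,
  and \<open>H\<close> for the given polynomial.  The idea is to construct the chain map backwards, through
  duality.  If \<open>H I \<subseteq> J\<close>, then multiplication by \<open>H\<close> is a map from \<open>R/I\<close> to \<open>R/J\<close>.  It lifts to a map from
  the resolution of \<open>R/I\<close> to its Frobenius power, which resolves \<open>R/J\<close> as Frobenius is flat.  Both
  complexes are self-dual, so the transposed lift is a chain map from the Frobenius power to
  the resolution with \<open>H\<close> in the last degree.  Its component in degree zero is homogeneous of degree
  zero, that is, a constant \<open>c\<close> (\<open>lift_of_multiplication\<close>, \<open>dual_chain_map\<close>).  If \<open>c\<close> were zero, the chain map
  would be null-homotopic and \<open>H\<close> would lie in \<open>J\<close> (\<open>dual_constant_nonzero\<close>).  So if \<open>H\<close> is not in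
  \<open>J\<close>, division by \<open>c\<close> makes the component in degree zero the identity; the remaining factor in the last
  degree is absorbed into the choice of the basis.

  Duality is used in the explicit form of the Gulliksen--Negard complex, whose third and fourth
  differentials are the transposes of the second and the first, up to a permutation of the basis.
  A comparison map from it to an arbitrary resolution of the given shape consists of square matrices
  of constants, for degree reasons, and it is invertible as soon as the columns of each explicit
  differential are linearly independent over the field (\<open>comparison_step\<close>,
  \<open>resolution_comparison\<close>).  So the explicit complex is exact because the resolution is.

  It remains to show \<open>H I \<subseteq> J\<close> and \<open>H \<notin> J\<close>.  Modulo \<open>J\<close> a monomial depends only on the set of variables with
  odd exponent and on the row and column sums of its table of exponents
  (\<open>frob_congr_monomials\<close>).  All monomials of \<open>H\<close> have row and column sums two, and each of the sixteen sets
  of positions with even row and column counts is the set of odd exponents of an odd number of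
  them.  Hence \<open>H\<close> is congruent to one sum over all these even sets, and the two terms of a minor
  multiply it to congruent polynomials, because together their four variables form an even set,
  which only permutes the sum (\<open>H0_mult_cof_mem\<close>).  On the other hand, the sum of the coefficients at the
  squares of monomials with row and column sums one is a functional that vanishes on \<open>J\<close>, and its
  value on \<open>H\<close> is the cardinality of \<open>S\<close>, which is odd (\<open>H0_not_mem\<close>).
\<close>

hide_const (open) Transposition.transpose
hide_fact (open) Transposition.transpose_def
no_notation fps_nth (infixl "$" 75)

section \<open>Polynomials by linear extension from monomials\<close>

abbreviation monomial :: "monom33 \<Rightarrow> 'k::field poly33" where
  "monomial t \<equiv> Poly_Mapping.single t 1"

abbreviation var_exp :: "3 \<Rightarrow> 3 \<Rightarrow> monom33" where
  "var_exp i j \<equiv> Poly_Mapping.single (i, j) 1"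

lemma const_simps [simp]:
  "const 0 = 0" "const 1 = 1" "const (a + b) = const a + const b" "const (a * b) = const a * const b"
  by (simp_all add: const_def single_add mult_single)

lemma const_mult_single [simp]: "const c * Poly_Mapping.single t d = Poly_Mapping.single t (c * d)"
  by (simp add: const_def mult_single)

lemma const_sum: "const (sum f A) = (\<Sum>i\<in>A. const (f i))"
  by (induction A rule: infinite_finite_induct) auto

lemma poly_eq_sum_monomials:
  "p = (\<Sum>t\<in>Poly_Mapping.keys p. Poly_Mapping.single t (Poly_Mapping.lookup p t))"
  by (rule poly_mapping_eqI)
    (auto simp: lookup_sum lookup_single when_def in_keys_iff sum.delta)

lemma poly_induct [case_names zero single add]:
  assumes "P 0" "\<And>t c. P (Poly_Mapping.single t c)" "\<And>p q. P p \<Longrightarrow> P q \<Longrightarrow> P (p + q)"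
  shows "P (p :: 'a \<Rightarrow>\<^sub>0 'b::comm_monoid_add)"
proof -
  have "P (\<Sum>t\<in>A. Poly_Mapping.single t (Poly_Mapping.lookup p t))" if "finite A" for A
    using that by induction (auto intro: assms)
  from this[of "Poly_Mapping.keys p"] show ?thesis
    using poly_eq_sum_monomials[of p] by simp
qed

text \<open>All the maps between polynomials that occur below (homogeneous parts, the substitution
  \<open>z \<mapsto> z\<^sup>2\<close>, its coefficient maps, the orbit action, a coefficient functional) are given by
  their values on monomials, so identities between them need only be verified there.\<close>

definition lin_ext :: "(monom33 \<Rightarrow> 'k poly33) \<Rightarrow> 'k poly33 \<Rightarrow> 'k::field poly33" where
  "lin_ext f p = (\<Sum>t\<in>Poly_Mapping.keys p. const (Poly_Mapping.lookup p t) * f t)"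

lemma lin_ext_superset:
  assumes "finite A" "Poly_Mapping.keys p \<subseteq> A"
  shows "lin_ext f p = (\<Sum>t\<in>A. const (Poly_Mapping.lookup p t) * f t)"
  unfolding lin_ext_def using assms
  by (intro sum.mono_neutral_left) (auto simp: in_keys_iff)

lemma lin_ext_simps [simp]:
  "lin_ext f 0 = 0"
  "lin_ext f (Poly_Mapping.single t c) = const c * f t"
  "lin_ext f (p + q) = lin_ext f p + lin_ext f q"
proof -
  let ?A = "Poly_Mapping.keys p \<union> Poly_Mapping.keys q"
  show "lin_ext f (p + q) = lin_ext f p + lin_ext f q"
    using keys_add[of p q]
    by (simp add: lin_ext_superset[of ?A] lookup_add distrib_right sum.distrib)
qed (auto simp: lin_ext_def)

lemma lin_ext_sum: "lin_ext f (sum g A) = (\<Sum>i\<in>A. lin_ext f (g i))"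
  by (induction A rule: infinite_finite_induct) auto

text \<open>Bilinear identities follow from the case of two monomials.\<close>

lemma lin_ext_mult_eqI:
  assumes "\<And>s t. s \<in> Poly_Mapping.keys p \<Longrightarrow> f (s + t) = h s * g t"
  shows "lin_ext f (p * q) = lin_ext h p * lin_ext g q"
proof (induction q rule: poly_induct)
  case (single t c)
  have "lin_ext f (p * Poly_Mapping.single t c) =
      lin_ext f (\<Sum>s\<in>Poly_Mapping.keys p. Poly_Mapping.single (s + t) (Poly_Mapping.lookup p s * c))"
    by (subst (1) poly_eq_sum_monomials[of p]) (simp add: sum_distrib_right mult_single)
  also have "\<dots> = (\<Sum>s\<in>Poly_Mapping.keys p. const (Poly_Mapping.lookup p s) * h s * (const c * g t))"
    by (simp add: lin_ext_sum assms mult_ac)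
  also have "\<dots> = lin_ext h p * (const c * g t)"
    by (simp add: lin_ext_def sum_distrib_right)
  finally show ?case by simp
qed (simp_all add: distrib_left)

lemma lin_ext_monomial [simp]: "lin_ext monomial p = p"
  by (simp add: lin_ext_def flip: poly_eq_sum_monomials)

section \<open>Graded maps and graded lifts\<close>

lemma mdeg_add: "mdeg (s + t) = mdeg s + mdeg t"
  by (simp add: mdeg_def lookup_add sum.distrib)

lemma mdeg_eq_0_iff: "mdeg t = 0 \<longleftrightarrow> t = 0"
  by (auto simp: mdeg_def intro: poly_mapping_eqI)

text \<open>The shift is kept on the other side of the equation, as in the notion of graded map, so
  that no truncated subtraction of degrees appears.\<close>

definition graded_part :: "nat \<Rightarrow> nat \<Rightarrow> 'k poly33 \<Rightarrow> 'k::field poly33" where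
  "graded_part n m = lin_ext (\<lambda>t. if mdeg t + m = n then monomial t else 0)"

lemma graded_part_mult:
  assumes "\<forall>t\<in>Poly_Mapping.keys p. mdeg t + b = a"
  shows "graded_part c b (p * q) = p * graded_part c a q"
proof -
  have "graded_part c b (p * q) =
      lin_ext monomial p * lin_ext (\<lambda>t. if mdeg t + a = c then monomial t else 0) q"
    unfolding graded_part_def using assms
    by (intro lin_ext_mult_eqI) (auto simp: mdeg_add mult_single)
  then show ?thesis by (simp add: graded_part_def)
qed

lemma graded_part_id:
  assumes "\<forall>t\<in>Poly_Mapping.keys p. mdeg t + b = a"
  shows "graded_part a b p = p"
proof -
  have "graded_part a b p = lin_ext monomial p"
    unfolding graded_part_def lin_ext_def using assms by (intro sum.cong) auto
  then show ?thesis by simp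
qed

lemma keys_graded_part: "t \<in> Poly_Mapping.keys (graded_part n m p) \<Longrightarrow> mdeg t + m = n"
  unfolding graded_part_def lin_ext_def
  by (drule subsetD[OF keys_sum]) (auto split: if_splits)

text \<open>Lift without regard to the grading, then keep the homogeneous part of the right degree.\<close>

lemma graded_factor:
  fixes A :: "'k::field poly33 ^ 'p ^ 'n" and C :: "'k poly33 ^ 'q ^ 'n"
  assumes A: "graded_map a b A" and C: "graded_map c b C"
    and rng: "\<And>x. C *v x \<in> range ((*v) A)"
  shows "\<exists>X. graded_map c a X \<and> C = A ** X"
proof -
  have "\<exists>y. A *v y = column j C" for j
  proof -
    have "C *v axis j 1 = column j C"
      by (simp add: matrix_vector_mult_def column_def axis_def vec_eq_iff if_distrib cong: if_cong)
    then show ?thesis using rng[of "axis j 1"] by (metis rangeE)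
  qed
  then obtain y where y: "\<And>j. A *v y j = column j C" by metis
  define X where "X = (\<chi> i j. graded_part c a (y j $ i))"
  have "(A ** X) $ i $ j = C $ i $ j" for i j
  proof -
    have "(A ** X) $ i $ j = (\<Sum>k\<in>UNIV. graded_part c b (A $ i $ k * y j $ k))"
      using A by (auto simp: matrix_matrix_mult_def X_def graded_map_def intro!: sum.cong graded_part_mult[symmetric])
    also have "\<dots> = graded_part c b ((A *v y j) $ i)"
      by (simp add: matrix_vector_mult_def graded_part_def lin_ext_sum)
    also have "\<dots> = C $ i $ j"
      using C by (auto simp: y column_def graded_map_def intro!: graded_part_id)
    finally show ?thesis .
  qed
  then have "C = A ** X" by (simp add: vec_eq_iff)
  moreover have "graded_map c a X"
    by (auto simp: graded_map_def X_def dest: keys_graded_part)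
  ultimately show ?thesis by blast
qed

lemma graded_lift:
  assumes "exact_at A B" "graded_map a b A" "graded_map c b C" "B ** C = 0"
  shows "\<exists>X. graded_map c a X \<and> C = A ** X"
proof (rule graded_factor[OF assms(2,3)])
  fix x
  have "B *v (C *v x) = 0" by (simp add: matrix_vector_mul_assoc assms(4))
  then show "C *v x \<in> range ((*v) A)" using assms(1) by (auto simp: exact_at_def)
qed

lemma graded_map_mult:
  assumes "graded_map a b A" "graded_map c a B"
  shows "graded_map c b (A ** B)"
  unfolding graded_map_def
proof (intro allI ballI)
  fix i j t assume "t \<in> Poly_Mapping.keys ((A ** B) $ i $ j)"
  then obtain k where "t \<in> Poly_Mapping.keys (A $ i $ k * B $ k $ j)"
    unfolding matrix_matrix_mult_def using keys_sum by fastforce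
  then obtain u v where "t = u + v" "u \<in> Poly_Mapping.keys (A $ i $ k)" "v \<in> Poly_Mapping.keys (B $ k $ j)"
    using keys_mult by blast
  then show "mdeg t + b = c" using assms by (force simp: graded_map_def mdeg_add)
qed

lemma graded_map_transpose: "graded_map a b (transpose A) \<longleftrightarrow> graded_map a b A"
  by (auto simp: graded_map_def transpose_def)

lemma graded_map_shift: "graded_map a b A \<Longrightarrow> a + d = c + b \<Longrightarrow> graded_map c d A"
  unfolding graded_map_def by fastforce

section \<open>Comparing two complexes through matrices of constants\<close>

definition const_mat :: "'k::field ^ 'c ^ 'r \<Rightarrow> 'k poly33 ^ 'c ^ 'r" where
  "const_mat M = (\<chi> i j. const (M $ i $ j))"

definition const_vec :: "'k::field ^ 'n \<Rightarrow> 'k poly33 ^ 'n" where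
  "const_vec x = (\<chi> i. const (x $ i))"

lemma const_mat_mult: "const_mat (A ** B) = const_mat A ** const_mat B"
  by (simp add: const_mat_def matrix_matrix_mult_def vec_eq_iff const_sum)

lemma const_mat_mult_const_vec: "const_mat A *v const_vec x = const_vec (A *v x)"
  by (simp add: const_mat_def const_vec_def matrix_vector_mult_def vec_eq_iff const_sum)

lemma const_mat_1 [simp]: "const_mat (mat 1) = mat 1"
  by (simp add: const_mat_def mat_def vec_eq_iff)

lemma graded_map_const_mat: "graded_map n n (const_mat M)"
  by (simp add: graded_map_def const_mat_def const_def mdeg_def)

lemma graded_map_eq_const_mat:
  assumes "graded_map n n A"
  shows "\<exists>M. A = const_mat M"
proof
  have "A $ i $ j = const (Poly_Mapping.lookup (A $ i $ j) 0)" for i j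
  proof (rule poly_mapping_eqI)
    fix t
    have "t = 0" if "t \<in> Poly_Mapping.keys (A $ i $ j)"
      using assms that by (auto simp: graded_map_def mdeg_eq_0_iff)
    then show "Poly_Mapping.lookup (A $ i $ j) t =
        Poly_Mapping.lookup (const (Poly_Mapping.lookup (A $ i $ j) 0)) t"
      by (auto simp: const_def lookup_single when_def in_keys_iff)
  qed
  then show "A = const_mat (\<chi> i j. Poly_Mapping.lookup (A $ i $ j) 0)"
    by (simp add: const_mat_def vec_eq_iff)
qed

text \<open>Linear independence of the columns over the field of coefficients.\<close>

definition const_inj :: "'k::field poly33 ^ 'c ^ 'r \<Rightarrow> bool" where
  "const_inj D \<longleftrightarrow> (\<forall>x. D *v const_vec x = 0 \<longrightarrow> x = 0)"

text \<open>The lift \<open>X\<close> of \<open>const_mat M ** D\<close> through \<open>d\<close> has degree zero, so it is a square matrix of constants,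
  and a constant vector killed by it is killed by \<open>D\<close>; hence it is invertible.  Once all
  differentials are compared in this way, the complex of \<open>D\<close> inherits exactness.\<close>

lemma comparison_step:
  fixes d :: "'k::field poly33 ^ 'n ^ 'm" and D :: "'k poly33 ^ 'n ^ 'm"
  assumes d: "graded_map b a d" and D: "graded_map b a D" and M: "N ** M = mat 1"
    and rng: "\<And>x. (const_mat M ** D) *v x \<in> range ((*v) d)" and inj: "const_inj D"
  shows "\<exists>M' N'. N' ** M' = mat 1 \<and> M' ** N' = mat 1 \<and> d ** const_mat M' = const_mat M ** D"
proof -
  obtain X where X: "graded_map b b X" "const_mat M ** D = d ** X"
    using graded_factor[OF d graded_map_mult[OF graded_map_const_mat D] rng] by blast
  obtain M' where M': "X = const_mat M'" using graded_map_eq_const_mat[OF X(1)] by blast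
  have NM: "const_mat N ** const_mat M = mat 1" by (simp add: M flip: const_mat_mult)
  have "x = 0" if "M' *v x = 0" for x
  proof -
    have "(const_mat M ** D) *v const_vec x = d *v const_vec (M' *v x)"
      by (simp add: X(2) M' const_mat_mult_const_vec flip: matrix_vector_mul_assoc)
    also have "\<dots> = 0" using that by (simp add: const_vec_def flip: zero_vec_def)
    finally have "const_mat N *v ((const_mat M ** D) *v const_vec x) = 0" by simp
    then have "D *v const_vec x = 0"
      by (simp add: matrix_vector_mul_assoc matrix_mul_assoc NM)
    then show "x = 0" using inj by (simp add: const_inj_def)
  qed
  then obtain N' where "N' ** M' = mat 1"
    using matrix_left_invertible_ker[of M'] by blast
  then show ?thesis using X(2) M' matrix_left_right_inverse by metis
qed

lemma exact_at_transport:
  fixes d' :: "'a::comm_ring_1 ^ 'p ^ 'n" and D' :: "'a ^ 'p ^ 'n"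
  assumes ex: "exact_at d' d" and c: "d ** A = A0 ** D" and c': "d' ** A' = A ** D'"
    and inv: "B ** A = mat 1" "A' ** B' = mat 1" and z: "D ** D' = 0"
  shows "exact_at D' D"
  unfolding exact_at_def
proof (intro set_eqI iffI)
  fix y assume "y \<in> range ((*v) D')"
  then show "y \<in> {x. D *v x = 0}" by (auto simp: matrix_vector_mul_assoc z)
next
  fix y assume "y \<in> {x. D *v x = 0}"
  then have "d *v (A *v y) = 0"
    by (simp add: matrix_vector_mul_assoc c flip: matrix_vector_mul_assoc[of A0])
  then obtain w where w: "A *v y = d' *v w" using ex by (auto simp: exact_at_def)
  have "A *v y = (d' ** A') *v (B' *v w)"
    by (simp add: w inv flip: matrix_mul_assoc add: matrix_vector_mul_assoc)
  also have "\<dots> = A *v (D' *v (B' *v w))"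
    by (simp add: c' matrix_vector_mul_assoc matrix_mul_assoc)
  finally have "B *v (A *v y) = B *v (A *v (D' *v (B' *v w)))" by simp
  then have "y = D' *v (B' *v w)" by (simp add: matrix_vector_mul_assoc matrix_mul_assoc inv)
  then show "y \<in> range ((*v) D')" by blast
qed

section \<open>Flatness of Frobenius\<close>

lemma exponent_eqI: "(\<And>v. Poly_Mapping.lookup s v = Poly_Mapping.lookup t v) \<Longrightarrow> s = t"
  by (rule poly_mapping_eqI)

lift_definition ind :: "(3 \<times> 3) set \<Rightarrow> monom33" is "\<lambda>A v. if v \<in> A then 1 else 0"
  by simp

lift_definition half :: "monom33 \<Rightarrow> monom33" is "\<lambda>t v. t v div 2"
  by (rule finite)

definition odd_part :: "monom33 \<Rightarrow> (3 \<times> 3) set" where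
  "odd_part t = {v. odd (Poly_Mapping.lookup t v)}"

lemma lookup_ind: "Poly_Mapping.lookup (ind A) v = (if v \<in> A then 1 else 0)"
  by (simp add: ind.rep_eq)

lemma lookup_half: "Poly_Mapping.lookup (half t) v = Poly_Mapping.lookup t v div 2"
  by (simp add: half.rep_eq)

lemma exponent_decomp: "ind (odd_part t) + (half t + half t) = t"
  by (rule exponent_eqI) (auto simp: lookup_add lookup_ind lookup_half odd_part_def, presburger+)

lemma odd_part_shift [simp]: "odd_part (s + s + t) = odd_part t"
  by (simp add: odd_part_def lookup_add)

lemma half_shift: "half (s + s + t) = s + half t" and half_double: "half (s + s) = s"
  by (rule exponent_eqI, simp add: lookup_add lookup_half)+

definition square_vars :: "'k poly33 \<Rightarrow> 'k::field poly33" where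
  "square_vars = lin_ext (\<lambda>t. monomial (t + t))"

definition square_coeff :: "(3 \<times> 3) set \<Rightarrow> 'k poly33 \<Rightarrow> 'k::field poly33" where
  "square_coeff A = lin_ext (\<lambda>t. if odd_part t = A then monomial (half t) else 0)"

text \<open>The ring is free over the image of \<open>square_vars\<close> with the squarefree monomials as a basis, and
  \<open>square_coeff A\<close> is the coordinate belonging to the monomial of \<open>A\<close>.\<close>

lemma square_vars_expansion: "p = (\<Sum>A\<in>UNIV. monomial (ind A) * square_vars (square_coeff A p))"
proof (induction p rule: poly_induct)
  case (single t c)
  have "(\<Sum>A\<in>UNIV. monomial (ind A) * square_vars (square_coeff A (Poly_Mapping.single t c))) =
      (\<Sum>A\<in>UNIV. if odd_part t = A then Poly_Mapping.single t c else 0)"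
    using exponent_decomp[of t] by (intro sum.cong) (auto simp: square_coeff_def square_vars_def mult_single)
  then show ?case by simp
next
  case (add p q)
  then show ?case by (simp add: square_coeff_def square_vars_def distrib_left sum.distrib)
qed (simp add: square_coeff_def square_vars_def)

lemma square_vars_add: "square_vars (p + q) = square_vars p + square_vars q" by (simp add: square_vars_def)

lemma square_vars_mult: "square_vars (p * q) = square_vars p * square_vars q"
  unfolding square_vars_def by (rule lin_ext_mult_eqI) (simp add: mult_single algebra_simps)

lemma square_vars_sum: "square_vars (sum f A) = (\<Sum>i\<in>A. square_vars (f i))" by (simp add: square_vars_def lin_ext_sum)

lemma square_coeff_sum: "square_coeff A (sum f B) = (\<Sum>i\<in>B. square_coeff A (f i))"
  by (simp add: square_coeff_def lin_ext_sum)

lemma square_coeff_mult: "square_coeff A (square_vars p * q) = p * square_coeff A q"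
proof (induction p rule: poly_induct)
  case (single t c)
  have "square_coeff A (monomial (t + t) * q) = monomial t * square_coeff A q"
    unfolding square_coeff_def
    by (subst lin_ext_mult_eqI[where h = "\<lambda>s. monomial (half s)" and g = "\<lambda>t. if odd_part t = A then monomial (half t) else 0"])
      (auto simp: half_shift mult_single half_double)
  moreover have "square_coeff A (const c * r) = const c * square_coeff A r" for r
  proof -
    have "lin_ext f (const c * r) = lin_ext (\<lambda>_. 1) (const c) * lin_ext f r" for f
      by (rule lin_ext_mult_eqI) (auto simp: const_def split: if_splits)
    then show ?thesis by (simp add: square_coeff_def const_def)
  qed
  moreover have "square_vars (Poly_Mapping.single t c) = const c * monomial (t + t)"
    by (simp add: square_vars_def)
  ultimately have "square_coeff A (square_vars (Poly_Mapping.single t c) * q) = const c * monomial t * square_coeff A q"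
    by (simp only: mult.assoc)
  then show ?case by simp
qed (simp_all add: square_vars_def square_coeff_def distrib_right)

text \<open>A solution of the Frobenius power of a system is, coordinate by coordinate along the
  squarefree monomials, the image under \<open>square_vars\<close> of solutions of the system itself.  In
  characteristic two the hypotheses say that the entries have coefficients in the prime field.\<close>

lemma exact_at_frob_mat:
  fixes A :: "'k::field poly33 ^ 'p ^ 'n" and B :: "'k poly33 ^ 'n ^ 'm"
  assumes ex: "exact_at A B"
    and A: "\<And>i j. (A $ i $ j)\<^sup>2 = square_vars (A $ i $ j)" and B: "\<And>i j. (B $ i $ j)\<^sup>2 = square_vars (B $ i $ j)"
  shows "exact_at (frob_mat A) (frob_mat B)"
proof -
  have fA: "(frob_mat A *v (\<chi> j. square_vars (w $ j))) = (\<chi> i. square_vars ((A *v w) $ i))" for w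
    by (simp add: frob_mat_def matrix_vector_mult_def vec_eq_iff A square_vars_sum square_vars_mult)
  have fB: "(frob_mat B *v (\<chi> j. square_vars (w $ j))) = (\<chi> i. square_vars ((B *v w) $ i))" for w
    by (simp add: frob_mat_def matrix_vector_mult_def vec_eq_iff B square_vars_sum square_vars_mult)
  have expand: "x = (\<Sum>E\<in>UNIV. monomial (ind E) *s (\<chi> i. square_vars (square_coeff E (x $ i))))" for x :: "'k poly33 ^ 'a"
    by (simp add: vec_eq_iff flip: square_vars_expansion)
  have lin: "M *v (\<Sum>E\<in>F. c E *s v E) = (\<Sum>E\<in>F. c E *s (M *v v E))"
    for M :: "'k poly33 ^ 'b ^ 'a" and c :: "(3 \<times> 3) set \<Rightarrow> _" and v and F
    by (simp add: vec_eq_iff matrix_vector_mult_def sum_distrib_left sum_distrib_right mult_ac)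
      (intro allI sum.swap)
  show ?thesis
    unfolding exact_at_def
  proof (intro set_eqI iffI)
    fix y assume "y \<in> range ((*v) (frob_mat A))"
    then obtain x where x: "y = frob_mat A *v x" by blast
    have BA: "B *v (A *v w) = 0" for w using ex by (auto simp: exact_at_def)
    have "y = (\<Sum>E\<in>UNIV. monomial (ind E) *s (\<chi> i. square_vars ((A *v (\<chi> j. square_coeff E (x $ j))) $ i)))"
      unfolding x by (subst expand[of x]) (simp add: lin fA[of "\<chi> j. square_coeff _ (x $ j)", simplified])
    then have "frob_mat B *v y =
        (\<Sum>E\<in>UNIV. monomial (ind E) *s (\<chi> i. square_vars ((B *v (A *v (\<chi> j. square_coeff E (x $ j)))) $ i)))"
      by (simp only: lin fB)
    then have "frob_mat B *v y = 0"
      by (simp only: BA) (simp add: square_vars_def vec_eq_iff)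
    then show "y \<in> {x. frob_mat B *v x = 0}" by simp
  next
    fix y assume "y \<in> {x. frob_mat B *v x = 0}"
    then have y: "frob_mat B *v y = 0" by simp
    have "\<exists>w. A *v w = (\<chi> j. square_coeff E (y $ j))" for E
    proof -
      have "(B *v (\<chi> j. square_coeff E (y $ j))) $ i = square_coeff E ((frob_mat B *v y) $ i)" for i
        by (simp add: matrix_vector_mult_def frob_mat_def B square_coeff_mult square_coeff_sum)
      then have "B *v (\<chi> j. square_coeff E (y $ j)) = 0"
        by (simp add: vec_eq_iff y square_coeff_def)
      then have "(\<chi> j. square_coeff E (y $ j)) \<in> range ((*v) A)"
        using ex by (simp add: exact_at_def)
      then show ?thesis by (metis rangeE)
    qed
    then obtain w where w: "\<And>E. A *v w E = (\<chi> j. square_coeff E (y $ j))" by metis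
    have "frob_mat A *v (\<Sum>E\<in>UNIV. monomial (ind E) *s (\<chi> j. square_vars (w E $ j))) = y"
      by (simp add: lin fA w flip: expand)
    then show "y \<in> range ((*v) (frob_mat A))" by blast
  qed
qed

lemma square_vars_simps:
  shows "square_vars 0 = (0 :: 'k::field poly33)" "square_vars 1 = (1 :: 'k poly33)" "square_vars (z i j) = (z i j :: 'k poly33)\<^sup>2"
proof -
  have "square_vars (monomial 0) = (monomial 0 :: 'k poly33)" by (simp add: square_vars_def del: single_one)
  then show "square_vars 1 = (1 :: 'k poly33)" by simp
qed (simp_all add: square_vars_def z_def mult_single power2_eq_square)

section \<open>The Gulliksen--Negard complex in characteristic two\<close>

lemma three_distinct [simp]:
  "(1::3) \<noteq> 2" "(1::3) \<noteq> 3" "(2::3) \<noteq> 3" "(2::3) \<noteq> 1" "(3::3) \<noteq> 1" "(3::3) \<noteq> 2"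
  by simp_all

lemma char2_simps:
  assumes "CHAR('k::field) = 2"
  shows "p + p = (0::'k poly33)" "p + (p + q) = (q::'k poly33)"
    "- p = (p::'k poly33)" "p - q = (p + q ::'k poly33)"
proof -
  have "of_nat 2 = (0::'k)" using of_nat_CHAR[where 'a = 'k] assms by simp
  then have "(1::'k) + 1 = 0" by simp
  then have "(1::'k poly33) + 1 = 0"
    by (simp only: single_zero flip: single_one single_add)
  then have *: "r + r = 0" for r :: "'k poly33"
    using distrib_left[of r 1 1] by simp
  show "p + p = 0" "p + (p + q) = q" by (simp_all add: * flip: add.assoc)
  show m: "- p = p" for p :: "'k poly33" using *[of p] by (rule minus_unique)
  show "p - q = p + q" by (simp only: diff_conv_add_uminus m)
qed

lemma sum_pairs_3: "(\<Sum>x\<in>UNIV. f x) = (\<Sum>i\<in>UNIV. \<Sum>j\<in>UNIV. f (i :: 3, j :: 3))"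
  by (simp add: sum.cartesian_product flip: UNIV_Times_UNIV)

definition next3 :: "3 \<Rightarrow> 3" where
  "next3 i = (if i = 1 then 2 else if i = 2 then 3 else 1)"

lemma next3_simps [simp]: "next3 1 = 2" "next3 2 = 3" "next3 3 = 1"
  by (simp_all add: next3_def)

text \<open>With cyclic indices the cofactors of the generic matrix need no explicit signs.\<close>

definition cof :: "3 \<times> 3 \<Rightarrow> 'k::field poly33" where
  "cof = (\<lambda>(a, b). z (next3 a) (next3 b) * z (next3 (next3 a)) (next3 (next3 b)) -
                   z (next3 a) (next3 (next3 b)) * z (next3 (next3 a)) (next3 b))"

definition sl_index :: "(3 \<times> 3) set" where
  "sl_index = {(1,1), (1,2), (1,3), (2,1), (2,2), (2,3), (3,1), (3,2)}"

text \<open>A basis of the traceless matrices: the matrix units off the diagonal, and the two matrices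
  \<open>E\<^bsub>11\<^esub> + E\<^bsub>22\<^esub>\<close> and \<open>E\<^bsub>22\<^esub> + E\<^bsub>33\<^esub>\<close>, which have trace zero in characteristic two.\<close>

definition sl_basis :: "3 \<times> 3 \<Rightarrow> 3 \<Rightarrow> 3 \<Rightarrow> 'k::field poly33" where
  "sl_basis = (\<lambda>(i, j) k l.
     if i = j then (if k = l \<and> (k = i \<or> k = next3 i) then 1 else 0)
     else (if k = i \<and> l = j then 1 else 0))"

text \<open>The entries of \<open>s Z\<close> and \<open>Z s\<close>, where \<open>Z\<close> is the generic matrix and \<open>s\<close> runs through the basis.
  The matrix of cofactors pairs with \<open>Z s\<close> and with \<open>s Z\<close> to the trace of \<open>s\<close> times the determinant, so
  each of them is a relation between the cofactors.\<close>

definition gn_entry :: "3 \<times> 3 \<Rightarrow> bool \<times> 3 \<times> 3 \<Rightarrow> 'k::field poly33" where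
  "gn_entry = (\<lambda>(a, b) (left, p). if left then \<Sum>k\<in>UNIV. sl_basis p a k * z k b
                                     else \<Sum>k\<in>UNIV. z a k * sl_basis p k b)"

definition gn_index :: "(bool \<times> 3 \<times> 3) set" where
  "gn_index = UNIV \<times> sl_index"

text \<open>In characteristic two the basis and its reordering by \<open>sl_dual\<close> are dual to each other for the
  trace form.\<close>

definition sl_dual :: "bool \<times> 3 \<times> 3 \<Rightarrow> bool \<times> 3 \<times> 3" where
  "sl_dual = (\<lambda>(left, i, j). (left, if i = j then (if i = 1 then (2, 2) else (1, 1)) else (j, i)))"

lemma sum_gn_index:
  "(\<Sum>x\<in>gn_index. f x) = (\<Sum>p\<in>sl_index. f (False, p)) + (\<Sum>p\<in>sl_index. f (True, p))"
proof -
  have "(\<Sum>x\<in>gn_index. f x) = (\<Sum>b\<in>UNIV. \<Sum>p\<in>sl_index. f (b, p))"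
    by (simp add: gn_index_def sum.cartesian_product)
  then show ?thesis by (simp add: UNIV_bool)
qed

lemma sl_dual_mem: "p \<in> gn_index \<Longrightarrow> sl_dual p \<in> gn_index"
  and sl_dual_dual: "p \<in> gn_index \<Longrightarrow> sl_dual (sl_dual p) = p"
  by (auto simp: gn_index_def sl_index_def sl_dual_def)

lemma cof_gn_entry:
  assumes "CHAR('k::field) = 2" "p \<in> gn_index"
  shows "(\<Sum>x\<in>UNIV. cof x * gn_entry x p) = (0::'k poly33)"
proof -
  note c = char2_simps[OF assms(1)]
  show ?thesis
    using assms(2) unfolding gn_index_def sl_index_def UNIV_bool
    by (elim SigmaE insertE emptyE, hypsubst)
      (simp_all add: sum_pairs_3 sum_3 gn_entry_def sl_basis_def,
       simp_all add: cof_def c distrib_left distrib_right mult_ac add_ac)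
qed

text \<open>The sum of \<open>s \<otimes> s'\<close> over dual bases of the traceless matrices is the flip of the two tensor
  factors plus the identity.  Left and right multiplication by it give the same result, so the two
  contributions cancel.\<close>

lemma gn_entry_pairing:
  assumes "CHAR('k::field) = 2"
  shows "(\<Sum>p\<in>gn_index. gn_entry x p * gn_entry y (sl_dual p)) = (0::'k poly33)"
proof -
  note c = char2_simps[OF assms(1)]
  obtain a b a' b' where x: "x = (a, b)" and y: "y = (a', b')" by fastforce
  have "(\<Sum>p\<in>sl_index. gn_entry x (False, p) * gn_entry y (sl_dual (False, p))) =
      z a b' * z a' b + (z a b * z a' b' :: 'k poly33)"
    using exhaust_3[of b] exhaust_3[of b'] unfolding x y sl_index_def
    by (elim disjE) (simp_all add: gn_entry_def sl_dual_def sl_basis_def sum_3 distrib_left distrib_right mult_ac add_ac c)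
  moreover have "(\<Sum>p\<in>sl_index. gn_entry x (True, p) * gn_entry y (sl_dual (True, p))) =
      z a b' * z a' b + (z a b * z a' b' :: 'k poly33)"
    using exhaust_3[of a] exhaust_3[of a'] unfolding x y sl_index_def
    by (elim disjE) (simp_all add: gn_entry_def sl_dual_def sl_basis_def sum_3 distrib_left distrib_right mult_ac add_ac c)
  ultimately show ?thesis by (simp add: sum_gn_index c)
qed

subsection \<open>Linear independence of the columns\<close>

lemma lookup_const_mult [simp]: "Poly_Mapping.lookup (const c * p) t = c * Poly_Mapping.lookup p t"
  by (induction p rule: poly_induct) (auto simp: lookup_single when_def lookup_add distrib_left)

lemma var_exp_add_eq_iff [unfolded One_nat_def]:
  "Poly_Mapping.single p (1::nat) + Poly_Mapping.single q 1 = Poly_Mapping.single r (1::nat) + Poly_Mapping.single s 1 \<longleftrightarrow>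
     p = r \<and> q = s \<or> p = s \<and> q = r"
proof
  assume "Poly_Mapping.single p 1 + Poly_Mapping.single q 1 = Poly_Mapping.single r (1::nat) + Poly_Mapping.single s 1"
  then have "Poly_Mapping.lookup (Poly_Mapping.single p 1 + Poly_Mapping.single q 1) v =
      Poly_Mapping.lookup (Poly_Mapping.single r (1::nat) + Poly_Mapping.single s 1) v" for v by simp
  from this[of p] this[of q] show "p = r \<and> q = s \<or> p = s \<and> q = r"
    by (auto simp: lookup_add lookup_single when_def split: if_splits)
qed (auto simp: add.commute)

lemma lookup_z [unfolded One_nat_def]: "Poly_Mapping.lookup (z i j :: 'k::field poly33) (var_exp k l) = (if i = k \<and> j = l then 1 else 0)"
proof -
  have "var_exp i j = var_exp k l \<longleftrightarrow> i = k \<and> j = l"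
    by (metis lookup_single_eq lookup_single_not_eq one_neq_zero prod.inject)
  then show ?thesis by (auto simp: z_def lookup_single when_def)
qed

lemma cof_independent:
  fixes y :: "3 \<times> 3 \<Rightarrow> 'k::field"
  assumes "(\<Sum>x\<in>UNIV. const (y x) * cof x) = 0"
  shows "y x = 0"
proof -
  obtain a b where x: "x = (a, b)" by fastforce
  let ?m = "var_exp (next3 a) (next3 b) + var_exp (next3 (next3 a)) (next3 (next3 b))"
  have [simp]: "next3 i = next3 j \<longleftrightarrow> i = j" "next3 (next3 i) \<noteq> i" "i \<noteq> next3 (next3 i)" "next3 i \<noteq> i" "i \<noteq> next3 i" for i j
    using exhaust_3[of i] exhaust_3[of j] by (auto simp: next3_def)
  have "Poly_Mapping.lookup (z i j * z k l :: 'k poly33) ?m =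
      (if (i, j) = (next3 a, next3 b) \<and> (k, l) = (next3 (next3 a), next3 (next3 b)) \<or>
          (i, j) = (next3 (next3 a), next3 (next3 b)) \<and> (k, l) = (next3 a, next3 b) then 1 else 0)" for i j k l
    unfolding z_def mult_single lookup_single when_def One_nat_def var_exp_add_eq_iff by simp
  then have L: "Poly_Mapping.lookup (cof w :: 'k poly33) ?m = (if w = x then 1 else 0)" for w
    by (cases w) (auto simp: x cof_def lookup_minus)
  have "Poly_Mapping.lookup (\<Sum>w\<in>UNIV. const (y w) * cof w) ?m = y x"
    unfolding lookup_sum lookup_const_mult L by (simp add: if_distrib cong: if_cong)
  then show ?thesis using assms by simp
qed

text \<open>A relation between the columns is an identity \<open>Z X + Y Z = 0\<close> with matrices of constants
  \<open>X\<close> and \<open>Y\<close> in the span of the basis.  Comparing coefficients shows that both are scalar matrices,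
  and zero is the only scalar matrix in that span.\<close>

lemma gn_entry_columns_independent:
  fixes y :: "bool \<times> 3 \<times> 3 \<Rightarrow> 'k::field"
  assumes rel: "\<And>x. (\<Sum>p\<in>gn_index. const (y p) * gn_entry x p) = 0"
    and p: "p \<in> gn_index"
  shows "y p = 0"
proof -
  define s :: "3 \<times> 3 \<Rightarrow> 3 \<Rightarrow> 3 \<Rightarrow> 'k" where
    "s q k l = Poly_Mapping.lookup (sl_basis q k l) 0" for q k l
  have s: "sl_basis q k l = const (s q k l)" for q k l
    by (auto simp: s_def sl_basis_def split: prod.splits)
  have L: "Poly_Mapping.lookup (gn_entry (a, b) (False, q)) (var_exp i j) = (if i = a then s q j b else 0)"
    and R: "Poly_Mapping.lookup (gn_entry (a, b) (True, q)) (var_exp i j) = (if j = b then s q a i else 0)" for a b i j q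
  proof -
    show "Poly_Mapping.lookup (gn_entry (a, b) (False, q)) (var_exp i j) = (if i = a then s q j b else 0)"
      using exhaust_3[of j] by (auto simp: gn_entry_def s sum_3 lookup_add lookup_z mult.commute[of "z _ _"])
    show "Poly_Mapping.lookup (gn_entry (a, b) (True, q)) (var_exp i j) = (if j = b then s q a i else 0)"
      using exhaust_3[of i] by (auto simp: gn_entry_def s sum_3 lookup_add lookup_z)
  qed
  define X where "X k l = (\<Sum>q\<in>sl_index. y (False, q) * s q k l)" for k l
  define Y where "Y k l = (\<Sum>q\<in>sl_index. y (True, q) * s q k l)" for k l
  have E: "(if i = a then X j b else 0) + (if j = b then Y a i else 0) = 0" for a b i j
  proof -
    have "Poly_Mapping.lookup (\<Sum>p\<in>gn_index. const (y p) * gn_entry (a, b) p) (var_exp i j) = 0"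
      by (simp add: rel)
    then show ?thesis
      by (cases "i = a"; cases "j = b")
        (simp_all add: sum_gn_index lookup_add lookup_sum L[unfolded One_nat_def]
          R[unfolded One_nat_def] X_def Y_def)
  qed
  have off: "X k l = 0" "Y k l = 0" if "k \<noteq> l" for k l
  proof -
    show "X k l = 0" using E[where a = 1 and b = l and i = 1 and j = k] that by (simp only: if_True if_False refl add_0_right)
    show "Y k l = 0" using E[where a = k and b = 1 and i = l and j = 1] that[symmetric] by (simp only: if_True if_False refl add_0_left)
  qed
  have diag: "X k k + Y l l = 0" for k l using E[where a = l and b = k and i = l and j = k] by simp
  have s': "s q k l = (if fst q = snd q then (if k = l \<and> (k = fst q \<or> k = next3 (fst q)) then 1 else 0)
       else (if k = fst q \<and> l = snd q then 1 else 0))" for q k l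
    by (auto simp: s_def sl_basis_def split: prod.splits)
  have X: "X 1 1 = y (False,1,1)" "X 2 2 = y (False,1,1) + y (False,2,2)" "X 3 3 = y (False,2,2)"
    "X 1 2 = y (False,1,2)" "X 1 3 = y (False,1,3)" "X 2 1 = y (False,2,1)" "X 2 3 = y (False,2,3)"
    "X 3 1 = y (False,3,1)" "X 3 2 = y (False,3,2)"
    by (simp_all add: X_def sl_index_def s')
  have Y: "Y 1 1 = y (True,1,1)" "Y 2 2 = y (True,1,1) + y (True,2,2)" "Y 3 3 = y (True,2,2)"
    "Y 1 2 = y (True,1,2)" "Y 1 3 = y (True,1,3)" "Y 2 1 = y (True,2,1)" "Y 2 3 = y (True,2,3)"
    "Y 3 1 = y (True,3,1)" "Y 3 2 = y (True,3,2)"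
    by (simp_all add: Y_def sl_index_def s')
  have scalar: "X k k = X l l" "Y k k = Y l l" for k l
    using diag by (metis add_right_cancel, metis add_left_cancel)
  have "y (False,2,2) = 0" using scalar(1)[of 1 2] unfolding X by simp
  moreover have "y (False,1,1) = 0" using scalar(1)[of 2 3] unfolding X by simp
  moreover have "y (True,2,2) = 0" using scalar(2)[of 1 2] unfolding Y by simp
  moreover have "y (True,1,1) = 0" using scalar(2)[of 2 3] unfolding Y by simp
  ultimately show ?thesis
    using p off X(4-9) Y(4-9) by (auto simp: gn_index_def sl_index_def UNIV_bool)
qed

lemma gn_entry_rows_independent:
  fixes y :: "3 \<times> 3 \<Rightarrow> 'k::field"
  assumes rel: "\<And>p. p \<in> gn_index \<Longrightarrow> (\<Sum>x\<in>UNIV. const (y x) * gn_entry x p) = 0"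
  shows "y x = 0"
proof -
  obtain a j where x: "x = (a, j)" by fastforce
  obtain i where i: "i \<noteq> j" by (cases "j = 1") (rule that[of 2], simp, rule that[of 1], simp)
  then have mem: "(False, i, j) \<in> gn_index"
    using exhaust_3[of i] exhaust_3[of j] by (auto simp: gn_index_def sl_index_def)
  have "gn_entry (c, d) (False, i, j) = (if d = j then z c i else 0 :: 'k poly33)" for c d
    using i exhaust_3[of i] by (auto simp: gn_entry_def sl_basis_def sum_3)
  then have "Poly_Mapping.lookup (\<Sum>x\<in>UNIV. const (y x) * gn_entry x (False, i, j)) (var_exp a i) = y (a, j)"
    using exhaust_3[of a] exhaust_3[of j]
    by (auto simp: sum_pairs_3 sum_3 lookup_add lookup_z)
  then show ?thesis using rel[OF mem] x by simp
qed

subsection \<open>The complex as a sequence of matrices\<close>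

definition enum9 :: "9 \<Rightarrow> 3 \<times> 3" where
  "enum9 = (SOME f. bij f)"

definition enum16 :: "16 \<Rightarrow> bool \<times> 3 \<times> 3" where
  "enum16 = (SOME f. bij_betw f UNIV gn_index)"

lemma bij_enum9: "bij enum9"
proof -
  have "\<exists>f. bij (f :: 9 \<Rightarrow> 3 \<times> 3)"
    by (rule finite_same_card_bij) simp_all
  then show ?thesis unfolding enum9_def by (rule someI_ex)
qed

lemma bij_enum16: "bij_betw enum16 UNIV gn_index"
proof -
  have "card gn_index = 16" by (simp add: gn_index_def card_cartesian_product sl_index_def)
  moreover have "finite gn_index" by (simp add: gn_index_def sl_index_def)
  ultimately have "\<exists>f. bij_betw (f :: 16 \<Rightarrow> _) UNIV gn_index"
    by (intro finite_same_card_bij) simp_all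
  then show ?thesis unfolding enum16_def by (rule someI_ex)
qed

lemma sum_enum9: "(\<Sum>r\<in>UNIV. f (enum9 r)) = (\<Sum>x\<in>UNIV. f x)"
  by (rule sum.reindex_bij_betw[OF bij_enum9])

lemma sum_enum16: "(\<Sum>r\<in>UNIV. f (enum16 r)) = (\<Sum>x\<in>gn_index. f x)"
  by (rule sum.reindex_bij_betw[OF bij_enum16])

lemma enum16_mem: "enum16 p \<in> gn_index"
  using bij_enum16 by (auto simp: bij_betw_def)

lemma enum16_eq_iff: "enum16 p = enum16 q \<longleftrightarrow> p = q"
  using bij_enum16 by (auto simp: bij_betw_def inj_def)

definition G1 :: "'k::field poly33 ^ 9 ^ 1" where
  "G1 = (\<chi> _ r. cof (enum9 r))"

definition G2 :: "'k::field poly33 ^ 16 ^ 9" where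
  "G2 = (\<chi> r p. gn_entry (enum9 r) (enum16 p))"

definition pairing :: "'k::field poly33 ^ 16 ^ 16" where
  "pairing = (\<chi> p q. if enum16 q = sl_dual (enum16 p) then 1 else 0)"

text \<open>The complex is self-dual by construction; \<open>pairing\<close> identifies its middle term with the dual
  of that term.\<close>

definition G3 :: "'k::field poly33 ^ 9 ^ 16" where
  "G3 = pairing ** transpose G2"

definition G4 :: "'k::field poly33 ^ 1 ^ 9" where
  "G4 = transpose G1"

lemma pairing_row: "(\<Sum>q\<in>UNIV. pairing $ p $ q * f (enum16 q)) = f (sl_dual (enum16 p))"
proof -
  have "(\<Sum>q\<in>UNIV. pairing $ p $ q * f (enum16 q)) =
      (\<Sum>x\<in>gn_index. if x = sl_dual (enum16 p) then f x else 0)"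
    by (subst sum_enum16[symmetric]) (rule sum.cong, simp_all add: pairing_def)
  also have "finite gn_index" by (simp add: gn_index_def sl_index_def)
  then have "(\<Sum>x\<in>gn_index. if x = sl_dual (enum16 p) then f x else 0) = f (sl_dual (enum16 p))"
    by (simp add: sl_dual_mem enum16_mem)
  finally show ?thesis .
qed

lemma transpose_pairing: "transpose pairing = pairing"
proof -
  have "enum16 q = sl_dual (enum16 p) \<longleftrightarrow> enum16 p = sl_dual (enum16 q)" for p q
    using sl_dual_dual[OF enum16_mem] by metis
  then show ?thesis by (simp add: transpose_def pairing_def vec_eq_iff)
qed

lemma pairing_pairing: "pairing ** pairing = (mat 1 :: 'k::field poly33 ^ 16 ^ 16)"
proof -
  have "(pairing ** pairing :: 'k poly33 ^ 16 ^ 16) $ p $ q = mat 1 $ p $ q" for p q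
  proof -
    have "(pairing ** pairing :: 'k poly33 ^ 16 ^ 16) $ p $ q =
       (\<Sum>r\<in>UNIV. pairing $ p $ r * (if enum16 q = sl_dual (enum16 r) then 1 else 0))"
      by (simp add: matrix_matrix_mult_def pairing_def)
    also have "\<dots> = mat 1 $ p $ q"
      by (simp add: pairing_row[where f = "\<lambda>x. if enum16 q = sl_dual x then 1 else 0"]
        sl_dual_dual enum16_mem enum16_eq_iff mat_def eq_commute)
    finally show ?thesis .
  qed
  then show ?thesis by (simp add: vec_eq_iff)
qed

lemma G1_G2: "CHAR('k::field) = 2 \<Longrightarrow> G1 ** G2 = (0 :: 'k poly33 ^ 16 ^ 1)"
  by (simp add: vec_eq_iff matrix_matrix_mult_def G1_def G2_def enum16_mem cof_gn_entry
    sum_enum9[where f = "\<lambda>x. cof x * gn_entry x _"])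

lemma G2_G3:
  assumes "CHAR('k::field) = 2"
  shows "G2 ** G3 = (0 :: 'k poly33 ^ 9 ^ 9)"
proof -
  have "(pairing ** transpose G2 :: 'k poly33 ^ 9 ^ 16) $ p $ s = gn_entry (enum9 s) (sl_dual (enum16 p))" for p s
    by (simp add: matrix_matrix_mult_def transpose_def G2_def pairing_row[where f = "gn_entry _"])
  then have "(G2 ** G3 :: 'k poly33 ^ 9 ^ 9) $ r $ s =
      (\<Sum>p\<in>UNIV. gn_entry (enum9 r) (enum16 p) * gn_entry (enum9 s) (sl_dual (enum16 p)))" for r s
    by (simp add: matrix_matrix_mult_def[of G2] G3_def) (simp add: G2_def)
  then show ?thesis
    using gn_entry_pairing[OF assms]
    by (simp add: vec_eq_iff sum_enum16[where f = "\<lambda>p. gn_entry _ p * gn_entry _ (sl_dual p)"])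
qed

lemma G3_G4: "CHAR('k::field) = 2 \<Longrightarrow> G3 ** G4 = (0 :: 'k poly33 ^ 1 ^ 16)"
  using G1_G2[where 'k = 'k]
  by (simp add: G3_def G4_def flip: matrix_mul_assoc matrix_transpose_mul)
    (simp add: transpose_def vec_eq_iff matrix_matrix_mult_def)

lemma sum_const_enum9:
  assumes "(\<Sum>r\<in>UNIV. h (enum9 r) * const (x $ r)) = 0"
  shows "(\<Sum>w\<in>UNIV. const (x $ inv enum9 w) * h w) = 0"
proof -
  have "(\<Sum>w\<in>UNIV. const (x $ inv enum9 w) * h w) = (\<Sum>r\<in>UNIV. const (x $ inv enum9 (enum9 r)) * h (enum9 r))"
    by (rule sum_enum9[symmetric])
  then show ?thesis using assms bij_enum9 by (simp add: bij_def mult.commute)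
qed

lemma const_inj_G1: "const_inj (G1 :: 'k::field poly33 ^ 9 ^ 1)"
  unfolding const_inj_def
proof (intro allI impI)
  fix x :: "'k ^ 9" assume "G1 *v const_vec x = 0"
  then have "(\<Sum>r\<in>UNIV. cof (enum9 r) * const (x $ r)) = 0"
    by (simp add: vec_eq_iff matrix_vector_mult_def G1_def const_vec_def)
  then have "x $ inv enum9 w = 0" for w
    using cof_independent[OF sum_const_enum9] by fast
  from this[of "enum9 _"] show "x = 0" using bij_enum9 by (simp add: vec_eq_iff bij_def)
qed

lemma const_inj_G2: "const_inj (G2 :: 'k::field poly33 ^ 16 ^ 9)"
  unfolding const_inj_def
proof (intro allI impI)
  fix x :: "'k ^ 16" assume x: "G2 *v const_vec x = 0"
  define y where "y = (\<lambda>p. x $ inv_into UNIV enum16 p)"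
  have inv: "inv_into UNIV enum16 (enum16 p) = p" for p
    using bij_enum16 by (auto simp: bij_betw_def)
  have "(\<Sum>p\<in>gn_index. const (y p) * gn_entry w p) = 0" for w
  proof -
    obtain r where r: "w = enum9 r" using bij_enum9 by (metis bij_pointE)
    have "(\<Sum>p\<in>gn_index. const (y p) * gn_entry w p) = (G2 *v const_vec x) $ r"
      by (subst sum_enum16[symmetric])
        (simp add: y_def inv r matrix_vector_mult_def G2_def const_vec_def mult.commute)
    then show ?thesis using x by simp
  qed
  then have "y (enum16 p) = 0" for p
    by (rule gn_entry_columns_independent) (rule enum16_mem)
  then show "x = 0" by (simp add: y_def inv vec_eq_iff)
qed

lemma const_inj_G3: "const_inj (G3 :: 'k::field poly33 ^ 9 ^ 16)"
  unfolding const_inj_def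
proof (intro allI impI)
  fix x :: "'k ^ 9" assume "G3 *v const_vec x = 0"
  then have "pairing *v (G3 *v const_vec x) = 0" by simp
  then have x: "transpose G2 *v const_vec x = 0"
    by (simp add: G3_def matrix_vector_mul_assoc matrix_mul_assoc pairing_pairing del: transpose_matrix_vector)
  have "(\<Sum>w\<in>UNIV. const (x $ inv enum9 w) * gn_entry w p) = 0" if "p \<in> gn_index" for p
  proof (rule sum_const_enum9[where h = "\<lambda>w. gn_entry w p"])
    from that have "p \<in> range enum16" using bij_enum16 by (simp add: bij_betw_def)
    then obtain q where q: "p = enum16 q" by blast
    have "(transpose G2 *v const_vec x) $ q = 0" by (simp only: x) simp
    then show "(\<Sum>r\<in>UNIV. gn_entry (enum9 r) p * const (x $ r)) = 0"
      by (simp add: q matrix_vector_mult_def transpose_def G2_def const_vec_def del: transpose_matrix_vector)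
  qed
  then have "x $ inv enum9 w = 0" for w by (rule gn_entry_rows_independent)
  from this[of "enum9 _"] show "x = 0" using bij_enum9 by (simp add: vec_eq_iff bij_def)
qed

lemma const_inj_G4: "const_inj (G4 :: 'k::field poly33 ^ 1 ^ 9)"
  unfolding const_inj_def
proof (intro allI impI)
  fix x :: "'k ^ 1" assume x: "G4 *v const_vec x = 0"
  define i where "i = inv enum9 (1, 1)"
  have i: "enum9 i = (1, 1)" unfolding i_def using bij_enum9 by (simp add: bij_def surj_f_inv_f)
  have "const (x $ 1) * cof (1, 1) = 0"
    using x unfolding vec_eq_iff
    by (auto simp: G4_def matrix_vector_mult_def transpose_def G1_def const_vec_def i mult.commute dest!: spec[of _ i])
  moreover have "(\<Sum>w\<in>UNIV. const (if w = (1, 1) then x $ 1 else 0) * cof w) =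
      (\<Sum>w\<in>(UNIV :: (3 \<times> 3) set). if w = (1, 1) then const (x $ 1) * cof (1, 1) else 0)"
    by (intro sum.cong) auto
  ultimately have "(\<Sum>w\<in>UNIV. const (if w = (1, 1) then x $ 1 else 0) * cof w) = 0"
    by simp
  from cof_independent[OF this, of "(1, 1)"] show "x = 0" by (simp add: vec_eq_iff)
qed

subsection \<open>Degrees and coefficients of the entries\<close>

definition homog :: "nat \<Rightarrow> 'k::field poly33 \<Rightarrow> bool" where
  "homog n p \<longleftrightarrow> (\<forall>t\<in>Poly_Mapping.keys p. mdeg t = n)"

lemma homog_0: "homog n 0" and homog_1: "homog 0 1"
  by (simp_all only: homog_def keys_zero keys_one ball_simps mdeg_eq_0_iff)

lemma homog_z: "homog 1 (z i j)"
  by (simp add: homog_def z_def mdeg_def lookup_single when_def)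

lemma homog_add: "homog n p \<Longrightarrow> homog n q \<Longrightarrow> homog n (p + q)"
  unfolding homog_def using keys_add[of p q] by blast

lemma homog_diff: "homog n p \<Longrightarrow> homog n q \<Longrightarrow> homog n (p - q)"
  unfolding homog_def using keys_diff[of p q] by blast

lemma homog_mult:
  assumes "homog m p" "homog n q"
  shows "homog (m + n) (p * q)"
  unfolding homog_def
proof
  fix t assume "t \<in> Poly_Mapping.keys (p * q)"
  then obtain u v where "t = u + v" "u \<in> Poly_Mapping.keys p" "v \<in> Poly_Mapping.keys q"
    using keys_mult by blast
  then show "mdeg t = m + n" using assms by (simp add: homog_def mdeg_add)
qed

lemmas homog_simps = homog_0 homog_1 homog_z homog_add homog_diff homog_mult

lemma homog_sum: "(\<And>i. i \<in> A \<Longrightarrow> homog n (f i)) \<Longrightarrow> homog n (sum f A)"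
  by (induction A rule: infinite_finite_induct) (auto intro: homog_simps)

lemma graded_map_homogI: "(\<And>i j. homog n (A $ i $ j)) \<Longrightarrow> a = n + b \<Longrightarrow> graded_map a b A"
  by (auto simp: homog_def graded_map_def)

lemma graded_G1: "graded_map 2 0 (G1 :: 'k::field poly33 ^ 9 ^ 1)"
proof (rule graded_map_homogI)
  have "homog (1 + 1) (cof x :: 'k poly33)" for x
    unfolding cof_def by (cases x) (simp only: prod.case homog_simps)
  then show "homog 2 (G1 $ i $ j :: 'k poly33)" for i j by (simp only: G1_def vec_lambda_beta one_add_one)
qed simp

lemma homog_gn_entry: "homog 1 (gn_entry x p :: 'k::field poly33)"
proof -
  have basis: "homog 0 (sl_basis q k l :: 'k poly33)" for q k l
  proof -
    have "sl_basis q k l = (0 :: 'k poly33) \<or> sl_basis q k l = (1 :: 'k poly33)"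
      by (cases q) (simp add: sl_basis_def)
    then show ?thesis by (elim disjE) (simp_all only: homog_simps)
  qed
  have 1: "homog 1 (sl_basis q k l * z i j :: 'k poly33)" for q k l i j
    using homog_simps(6)[OF basis homog_simps(3)] by (simp only: add_0_left)
  have 2: "homog 1 (z i j * sl_basis q k l :: 'k poly33)" for q k l i j
    using homog_simps(6)[OF homog_simps(3) basis] by (simp only: add_0_right)
  obtain a b left q where "x = (a, b)" "p = (left, q)" by (metis surj_pair)
  then show ?thesis
    unfolding gn_entry_def by (cases left) (simp_all only: prod.case if_True if_False homog_sum 1 2)
qed

lemma graded_G2: "graded_map 3 2 G2"
proof (rule graded_map_homogI)
  show "homog 1 (G2 $ i $ j)" for i j by (simp only: G2_def vec_lambda_beta homog_gn_entry)
qed simp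

lemma graded_pairing: "graded_map n n pairing"
  by (rule graded_map_homogI[of 0]) (auto simp: pairing_def homog_simps)

lemma graded_G3: "graded_map 4 3 G3"
  unfolding G3_def
  by (rule graded_map_mult[OF graded_pairing])
    (auto simp: graded_map_transpose intro: graded_map_shift[OF graded_G2])

lemma graded_G4: "graded_map 6 4 G4"
  by (auto simp: G4_def graded_map_transpose intro: graded_map_shift[OF graded_G1])

lemma frob_mat_transpose: "frob_mat (transpose A) = transpose (frob_mat A)"
  by (simp add: frob_mat_def transpose_def vec_eq_iff)

lemma frob_mat_pairing: "frob_mat pairing = pairing"
  by (simp add: frob_mat_def pairing_def vec_eq_iff)

context
  assumes char: "CHAR('k::field) = 2"
begin

lemma power2_add_char2: "(p + q)\<^sup>2 = p\<^sup>2 + (q\<^sup>2 :: 'k poly33)"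
  by (simp add: power2_eq_square distrib_left distrib_right char2_simps[OF char] add_ac mult_ac)

lemma power2_sum_char2: "(sum f A)\<^sup>2 = (\<Sum>i\<in>A. (f i)\<^sup>2 :: 'k poly33)"
  by (induction A rule: infinite_finite_induct) (auto simp: power2_add_char2)

lemma frob_mat_mult: "frob_mat (A ** B) = frob_mat A ** (frob_mat B :: 'k poly33 ^ _ ^ _)"
  by (simp add: frob_mat_def matrix_matrix_mult_def vec_eq_iff power2_sum_char2 power_mult_distrib)

lemma square_cof: "(cof x)\<^sup>2 = square_vars (cof x :: 'k poly33)"
  by (cases x) (simp add: cof_def char2_simps[OF char] power2_add_char2 power_mult_distrib square_vars_add square_vars_mult square_vars_simps)

lemma square_gn_entry: "(gn_entry x p)\<^sup>2 = square_vars (gn_entry x p :: 'k poly33)"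
proof -
  have "(sl_basis q k l)\<^sup>2 = square_vars (sl_basis q k l :: 'k poly33)" for q k l
    by (auto simp: sl_basis_def square_vars_simps split: prod.split)
  then show ?thesis
    by (auto simp: gn_entry_def power2_sum_char2 power_mult_distrib square_vars_sum square_vars_mult square_vars_simps split: prod.split)
qed

lemma square_G:
  "(G1 $ i $ j)\<^sup>2 = square_vars (G1 $ i $ j :: 'k poly33)" "(G2 $ r $ p)\<^sup>2 = square_vars (G2 $ r $ p :: 'k poly33)"
  "(G3 $ p $ r)\<^sup>2 = square_vars (G3 $ p $ r :: 'k poly33)" "(G4 $ j $ i)\<^sup>2 = square_vars (G4 $ j $ i :: 'k poly33)"
proof -
  have "(pairing $ p $ q)\<^sup>2 = square_vars (pairing $ p $ q :: 'k poly33)" for p q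
    by (simp add: pairing_def square_vars_simps)
  then show "(G3 $ p $ r)\<^sup>2 = square_vars (G3 $ p $ r :: 'k poly33)"
    by (simp add: G3_def matrix_matrix_mult_def transpose_def G2_def square_gn_entry
        power2_sum_char2 power_mult_distrib square_vars_sum square_vars_mult)
qed (simp_all add: G1_def G2_def G4_def transpose_def square_cof square_gn_entry)

end

section \<open>Monomials modulo the Frobenius power of the ideal of minors\<close>

definition frob_ideal :: "'k::field poly33 set" where
  "frob_ideal = {q. \<exists>c. q = (\<Sum>x\<in>UNIV. c x * (cof x)\<^sup>2)}"

lemma frob_idealI: "(\<Sum>x\<in>UNIV. c x * (cof x)\<^sup>2) \<in> frob_ideal"
  by (auto simp: frob_ideal_def)

lemma frob_ideal_0: "0 \<in> frob_ideal"
  using frob_idealI[of "\<lambda>_. 0"] by simp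

lemma frob_ideal_add: "p \<in> frob_ideal \<Longrightarrow> q \<in> frob_ideal \<Longrightarrow> p + q \<in> frob_ideal"
  unfolding frob_ideal_def
proof clarify
  fix c d :: "3 \<times> 3 \<Rightarrow> 'a poly33"
  show "\<exists>e. (\<Sum>x\<in>UNIV. c x * (cof x)\<^sup>2) + (\<Sum>x\<in>UNIV. d x * (cof x)\<^sup>2) = (\<Sum>x\<in>UNIV. e x * (cof x)\<^sup>2)"
    by (rule exI[of _ "\<lambda>x. c x + d x"]) (simp add: distrib_right sum.distrib)
qed

lemma frob_ideal_mult: "p \<in> frob_ideal \<Longrightarrow> r * p \<in> frob_ideal"
  unfolding frob_ideal_def
proof clarify
  fix c :: "3 \<times> 3 \<Rightarrow> 'a poly33"
  show "\<exists>e. r * (\<Sum>x\<in>UNIV. c x * (cof x)\<^sup>2) = (\<Sum>x\<in>UNIV. e x * (cof x)\<^sup>2)"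
    by (rule exI[of _ "\<lambda>x. r * c x"]) (simp add: sum_distrib_left mult_ac)
qed

lemma frob_ideal_sum: "(\<And>i. i \<in> A \<Longrightarrow> f i \<in> frob_ideal) \<Longrightarrow> sum f A \<in> frob_ideal"
  by (induction A rule: infinite_finite_induct) (auto intro: frob_ideal_0 frob_ideal_add)

lemma frob_ideal_cof: "(cof x)\<^sup>2 \<in> (frob_ideal :: 'k::field poly33 set)"
proof -
  have "(\<Sum>w\<in>UNIV. (if w = x then 1 else 0) * (cof w :: 'k poly33)\<^sup>2) = (\<Sum>w\<in>UNIV. if w = x then (cof w)\<^sup>2 else 0)"
    by (intro sum.cong) auto
  then have "(cof x :: 'k poly33)\<^sup>2 = (\<Sum>w\<in>UNIV. (if w = x then 1 else 0) * (cof w)\<^sup>2)" by simp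
  then show ?thesis using frob_idealI[of "\<lambda>w. if w = x then 1 else 0"] by (simp only:)
qed

definition frob_congr :: "'k poly33 \<Rightarrow> 'k::field poly33 \<Rightarrow> bool" where
  "frob_congr p q \<longleftrightarrow> p - q \<in> frob_ideal"

lemma frob_congr_refl: "frob_congr p p"
  by (simp add: frob_congr_def frob_ideal_0)

lemma frob_congr_trans: "frob_congr p q \<Longrightarrow> frob_congr q r \<Longrightarrow> frob_congr p r"
  using frob_ideal_add[of "p - q" "q - r"] by (simp add: frob_congr_def)

lemma frob_congr_sum: "(\<And>i. i \<in> A \<Longrightarrow> frob_congr (f i) (g i)) \<Longrightarrow> frob_congr (sum f A) (sum g A)"
  unfolding frob_congr_def sum_subtractf[symmetric] by (rule frob_ideal_sum)

lemma frob_congr_mult: "frob_congr p q \<Longrightarrow> frob_congr (p * r) (q * r)"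
  using frob_ideal_mult[of "p - q" r] by (simp add: frob_congr_def algebra_simps)

definition row_sum :: "monom33 \<Rightarrow> 3 \<Rightarrow> nat" where
  "row_sum t i = (\<Sum>j\<in>UNIV. Poly_Mapping.lookup t (i, j))"

definition col_sum :: "monom33 \<Rightarrow> 3 \<Rightarrow> nat" where
  "col_sum t j = (\<Sum>i\<in>UNIV. Poly_Mapping.lookup t (i, j))"

lemma row_sum_add [simp]: "row_sum (s + t) i = row_sum s i + row_sum t i"
  and col_sum_add [simp]: "col_sum (s + t) j = col_sum s j + col_sum t j"
  by (simp_all add: row_sum_def col_sum_def lookup_add sum.distrib)

lemma row_sum_single [simp]: "row_sum (Poly_Mapping.single (k, l) n) i = (if i = k then n else 0)"
  and col_sum_single [simp]: "col_sum (Poly_Mapping.single (k, l) n) j = (if j = l then n else 0)"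
proof -
  have "row_sum (Poly_Mapping.single (k, l) n) i = (\<Sum>j\<in>UNIV. if j = l then if i = k then n else 0 else 0)"
    unfolding row_sum_def by (intro sum.cong) (auto simp: lookup_single when_def)
  then show "row_sum (Poly_Mapping.single (k, l) n) i = (if i = k then n else 0)" by simp
  have "col_sum (Poly_Mapping.single (k, l) n) j = (\<Sum>i\<in>UNIV. if i = k then if j = l then n else 0 else 0)"
    unfolding col_sum_def by (intro sum.cong) (auto simp: lookup_single when_def)
  then show "col_sum (Poly_Mapping.single (k, l) n) j = (if j = l then n else 0)" by simp
qed

definition same_margins :: "monom33 \<Rightarrow> monom33 \<Rightarrow> bool" where
  "same_margins s t \<longleftrightarrow> (\<forall>i. row_sum s i = row_sum t i) \<and> (\<forall>j. col_sum s j = col_sum t j)"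

lemma next3_cycle: "next3 (next3 (next3 i)) = i"
  using exhaust_3[of i] by auto

lemma minor_square:
  assumes "i \<noteq> k" "j \<noteq> l"
  shows "\<exists>x. (z i j * z k l - z i l * z k j)\<^sup>2 = (cof x :: 'k::field poly33)\<^sup>2"
proof -
  have third: "\<exists>a. i = next3 a \<and> k = next3 (next3 a) \<or> k = next3 a \<and> i = next3 (next3 a)" if "i \<noteq> k" for i k :: 3
  proof -
    have "k = next3 i \<or> i = next3 k" using exhaust_3[of i] exhaust_3[of k] that by auto
    then show ?thesis
      by (elim disjE) (rule exI[of _ "next3 (next3 i)"], simp add: next3_cycle, rule exI[of _ "next3 (next3 k)"], simp add: next3_cycle)
  qed
  obtain a where a: "i = next3 a \<and> k = next3 (next3 a) \<or> k = next3 a \<and> i = next3 (next3 a)"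
    using third[OF assms(1)] by blast
  obtain b where b: "j = next3 b \<and> l = next3 (next3 b) \<or> l = next3 b \<and> j = next3 (next3 b)"
    using third[OF assms(2)] by blast
  let ?m = "z i j * z k l - z i l * z k j :: 'k poly33"
  have cof: "cof (a, b) = z (next3 a) (next3 b) * z (next3 (next3 a)) (next3 (next3 b)) -
      z (next3 a) (next3 (next3 b)) * (z (next3 (next3 a)) (next3 b) :: 'k poly33)" by (simp add: cof_def)
  have "?m = cof (a, b) \<or> ?m = - cof (a, b)"
    using a b unfolding cof
    by (elim disjE conjE; hypsubst) (simp_all only: minus_diff_eq mult.commute simp_thms)
  then have "?m\<^sup>2 = (cof (a, b))\<^sup>2" by (elim disjE) (simp_all only: power2_minus)
  then show ?thesis ..
qed

lemma exponent_split:
  assumes "Poly_Mapping.lookup v p \<noteq> (0::nat)"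
  shows "\<exists>r. v = Poly_Mapping.single p 1 + r"
proof
  show "v = Poly_Mapping.single p 1 + (v - Poly_Mapping.single p 1)"
    using assms by (intro poly_mapping_eqI) (auto simp: lookup_add lookup_minus lookup_single when_def)
qed

context
  assumes char: "CHAR('k::field) = 2"
begin

lemma square_exchange:
  "frob_congr (monomial (w + (var_exp i j + var_exp k l) + (var_exp i j + var_exp k l))) (monomial (w + (var_exp i l + var_exp k j) + (var_exp i l + var_exp k j)) :: 'k poly33)"
proof (cases "i = k \<or> j = l")
  case True
  then show ?thesis by (auto simp: frob_congr_refl add.commute)
next
  case False
  then obtain x where x: "(z i j * z k l - z i l * z k j)\<^sup>2 = (cof x :: 'k poly33)\<^sup>2"
    using minor_square by blast
  have "monomial w * (z i j * z k l - z i l * z k j)\<^sup>2 = monomial w * (z i j * z k l)\<^sup>2 - monomial w * (z i l * z k j :: 'k poly33)\<^sup>2"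
    by (simp add: char2_simps[OF char] power2_add_char2[OF char] distrib_left)
  also have "\<dots> = monomial (w + (var_exp i j + var_exp k l) + (var_exp i j + var_exp k l)) - monomial (w + (var_exp i l + var_exp k j) + (var_exp i l + var_exp k j))"
    by (simp add: z_def mult_single power2_eq_square add_ac)
  finally have "monomial w * (cof x)\<^sup>2 =
      monomial (w + (var_exp i j + var_exp k l) + (var_exp i j + var_exp k l)) - (monomial (w + (var_exp i l + var_exp k j) + (var_exp i l + var_exp k j)) :: 'k poly33)"
    unfolding x .
  moreover have "monomial w * (cof x)\<^sup>2 \<in> (frob_ideal :: 'k poly33 set)"
    by (intro frob_ideal_mult frob_ideal_cof)
  ultimately show ?thesis unfolding frob_congr_def by (simp only:)
qed

text \<open>Two tables of natural numbers with the same row and column sums are connected by exchanges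
  along \<open>2 \<times> 2\<close> minors: one exchange makes some entry positive in both tables, and it is
  then removed.\<close>

lemma frob_congr_double:
  assumes "same_margins u v"
  shows "frob_congr (monomial (w + u + u)) (monomial (w + v + v) :: 'k poly33)"
  using assms
proof (induction "mdeg u" arbitrary: u v w)
  case 0
  then have u: "u = 0" by (simp add: mdeg_eq_0_iff)
  have "Poly_Mapping.lookup v (i, j) = 0" for i j
  proof -
    have "row_sum v i = 0" using 0 u by (simp add: same_margins_def row_sum_def)
    then show ?thesis by (simp add: row_sum_def)
  qed
  then have "v = 0" by (intro poly_mapping_eqI) auto
  then show ?case by (simp add: u frob_congr_refl)
next
  case (Suc n)
  have "\<exists>i j. Poly_Mapping.lookup u (i, j) \<noteq> 0"
  proof (rule ccontr)
    assume "\<not> ?thesis"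
    then have "mdeg u = 0" by (simp add: mdeg_def)
    then show False using Suc(2) by simp
  qed
  then obtain i j where ij: "Poly_Mapping.lookup u (i, j) \<noteq> 0" by blast
  then obtain u1 where u1: "u = var_exp i j + u1" using exponent_split[OF ij] by blast
  have deg: "mdeg (var_exp i j) = 1" by (simp add: mdeg_def lookup_single when_def)
  have n: "n = mdeg u1" using Suc(2) unfolding u1 mdeg_add deg by simp
  have step: "frob_congr (monomial (w + u + u)) (monomial (w + v' + v') :: 'k poly33)"
    if v': "v' = var_exp i j + r" and m: "same_margins u v'" for v' r
  proof -
    have "same_margins u1 r" using m unfolding u1 v' same_margins_def by simp
    from Suc(1)[OF n this, of "w + var_exp i j + var_exp i j"] show ?thesis by (simp add: u1 v' add_ac)
  qed
  show ?case
  proof (cases "Poly_Mapping.lookup v (i, j) = 0")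
    case False
    then show ?thesis using exponent_split[OF False] step Suc(3) by blast
  next
    case True
    have "row_sum u i \<noteq> 0" "col_sum u j \<noteq> 0" unfolding u1 by simp_all
    then have "row_sum v i \<noteq> 0" "col_sum v j \<noteq> 0" using Suc(3) by (simp_all add: same_margins_def)
    then obtain k l where l: "Poly_Mapping.lookup v (i, l) \<noteq> 0" and k: "Poly_Mapping.lookup v (k, j) \<noteq> 0"
      unfolding row_sum_def col_sum_def by (meson sum.neutral)
    have "l \<noteq> j" using l True by auto
    obtain r1 where r1: "v = var_exp i l + r1" using exponent_split[OF l] by blast
    have kj: "Poly_Mapping.lookup r1 (k, j) \<noteq> 0"
      using k \<open>l \<noteq> j\<close> by (simp add: r1 lookup_add lookup_single when_def)
    obtain r where "r1 = var_exp k j + r" using exponent_split[OF kj] by blast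
    then have r: "v = var_exp i l + var_exp k j + r" by (simp add: r1 add_ac)
    define v' where "v' = var_exp i j + (var_exp k l + r)"
    have "same_margins u v'"
      using Suc(3) unfolding r v'_def same_margins_def by simp
    then have "frob_congr (monomial (w + u + u)) (monomial (w + v' + v') :: 'k poly33)" using step v'_def by blast
    moreover have "frob_congr (monomial (w + v' + v')) (monomial (w + v + v) :: 'k poly33)"
      using square_exchange[of "w + r + r" i j k l] by (simp add: v'_def r add_ac)
    ultimately show ?thesis by (rule frob_congr_trans)
  qed
qed

lemma frob_congr_monomials:
  assumes "odd_part s = odd_part t" "same_margins s t"
  shows "frob_congr (monomial s) (monomial t :: 'k poly33)"
proof -
  have s: "s = ind (odd_part t) + half s + half s" and t: "t = ind (odd_part t) + half t + half t"
    using exponent_decomp[of s] exponent_decomp[of t] assms(1) by (simp_all only: add.assoc)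
  have rows: "row_sum s i = row_sum (ind (odd_part t)) i + row_sum (half s) i + row_sum (half s) i"
    "row_sum t i = row_sum (ind (odd_part t)) i + row_sum (half t) i + row_sum (half t) i" for i
    by (subst s, simp only: row_sum_add) (subst t, simp only: row_sum_add)
  have cols: "col_sum s j = col_sum (ind (odd_part t)) j + col_sum (half s) j + col_sum (half s) j"
    "col_sum t j = col_sum (ind (odd_part t)) j + col_sum (half t) j + col_sum (half t) j" for j
    by (subst s, simp only: col_sum_add) (subst t, simp only: col_sum_add)
  have "same_margins (half s) (half t)"
    unfolding same_margins_def
  proof (intro conjI allI)
    fix i show "row_sum (half s) i = row_sum (half t) i"
      using assms(2) rows[of i] unfolding same_margins_def by (auto dest: spec[of _ i])
    show "col_sum (half s) i = col_sum (half t) i"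
      using assms(2) cols[of i] unfolding same_margins_def by (auto dest: spec[of _ i])
  qed
  from frob_congr_double[OF this, of "ind (odd_part t)"] show ?thesis
    by (simp only: s[symmetric] t[symmetric])
qed

end

section \<open>The orbits as tables with line sums two\<close>

lift_definition table :: "(3 \<times> 3 \<Rightarrow> nat) \<Rightarrow> monom33" is "\<lambda>f. f"
  by (rule finite)

text \<open>Monomials are regarded as \<open>3 \<times> 3\<close> tables of exponents.  The three orbits consist of these
  tables with all line sums two: \<open>1\<close> on the complement of the row and the column of a position and
  \<open>2\<close> at that position; \<open>1\<close> off the graph of a permutation; \<open>2\<close> on the graph of a permutation.\<close>

definition block_table :: "3 \<times> 3 \<Rightarrow> monom33" where
  "block_table = (\<lambda>(c, d). table (\<lambda>(i, j). if i = c \<and> j = d then 2 else if i \<noteq> c \<and> j \<noteq> d then 1 else 0))"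

definition cograph_table :: "(3 \<Rightarrow> 3) \<Rightarrow> monom33" where
  "cograph_table \<pi> = table (\<lambda>(i, j). if j = \<pi> i then 0 else 1)"

definition graph_table :: "(3 \<Rightarrow> 3) \<Rightarrow> monom33" where
  "graph_table \<pi> = table (\<lambda>(i, j). if j = \<pi> i then 2 else 0)"

lemma lookup_tables:
  "Poly_Mapping.lookup (block_table (c, d)) (i, j) = (if i = c \<and> j = d then 2 else if i \<noteq> c \<and> j \<noteq> d then 1 else 0)"
  "Poly_Mapping.lookup (cograph_table \<pi>) (i, j) = (if j = \<pi> i then 0 else 1)"
  "Poly_Mapping.lookup (graph_table \<pi>) (i, j) = (if j = \<pi> i then 2 else 0)"
  by (simp_all add: block_table_def cograph_table_def graph_table_def table.rep_eq)

lemma act_mult: "act \<sigma> \<tau> (p * q) = act \<sigma> \<tau> p * act \<sigma> \<tau> q"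
proof -
  have "subst f = lin_ext (\<lambda>t. \<Prod>v\<in>UNIV. f v ^ Poly_Mapping.lookup t v)" for f :: "3 \<times> 3 \<Rightarrow> 'a poly33"
    by (rule ext) (simp add: subst_def lin_ext_def)
  then show ?thesis
    unfolding act_def by (simp only:) (rule lin_ext_mult_eqI, simp add: lookup_add power_add prod.distrib)
qed

lemma act_z: "act \<sigma> \<tau> (z i j) = (z (\<sigma> i) (\<tau> j) :: 'k::field poly33)"
proof -
  have "(\<Prod>v\<in>UNIV. (case v of (a, b) \<Rightarrow> z (\<sigma> a) (\<tau> b)) ^ Poly_Mapping.lookup (var_exp i j) v) =
      (\<Prod>v\<in>UNIV. if v = (i, j) then z (\<sigma> i) (\<tau> j) else (1 :: 'k poly33))"
    by (intro prod.cong) (auto simp: lookup_single when_def)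
  then show ?thesis
    by (simp add: act_def subst_def z_def)
qed

lemmas act_simps = act_mult act_z power2_eq_square

lemma z_eq_monomial: "z i j = monomial (var_exp i j)"
  by (simp add: z_def)

lemma act_eta:
  assumes "bij \<sigma>" "bij \<tau>"
  shows "act \<sigma> \<tau> eta1 = (monomial (block_table (\<sigma> 3, \<tau> 1)) :: 'k::field poly33)"
    and "(\<And>i. \<pi> (\<sigma> i) = \<tau> i) \<Longrightarrow> act \<sigma> \<tau> eta2 = (monomial (cograph_table \<pi>) :: 'k poly33)"
    and "(\<And>i. \<pi> (\<sigma> i) = \<tau> (next3 i)) \<Longrightarrow> act \<sigma> \<tau> eta3 = (monomial (graph_table \<pi>) :: 'k poly33)"
proof -
  have inj: "\<sigma> i = \<sigma> j \<longleftrightarrow> i = j" "\<tau> i = \<tau> j \<longleftrightarrow> i = j" for i j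
    using assms by (auto simp: bij_def inj_eq)
  have reach: "\<exists>i j. v = (\<sigma> i, \<tau> j)" for v
    using assms by (metis bij_pointE surj_pair)
  have eqI: "s = t" if "\<And>i j. Poly_Mapping.lookup s (\<sigma> i, \<tau> j) = Poly_Mapping.lookup t (\<sigma> i, \<tau> j)" for s t :: monom33
  proof (rule exponent_eqI)
    fix v obtain i j where "v = (\<sigma> i, \<tau> j)" using reach by blast
    then show "Poly_Mapping.lookup s v = Poly_Mapping.lookup t v" using that by simp
  qed
  have "var_exp (\<sigma> 1) (\<tau> 2) + var_exp (\<sigma> 1) (\<tau> 3) + var_exp (\<sigma> 2) (\<tau> 2) + var_exp (\<sigma> 2) (\<tau> 3) + (var_exp (\<sigma> 3) (\<tau> 1) + var_exp (\<sigma> 3) (\<tau> 1)) =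
      block_table (\<sigma> 3, \<tau> 1)"
  proof (rule eqI)
    fix i j
    show "Poly_Mapping.lookup (var_exp (\<sigma> 1) (\<tau> 2) + var_exp (\<sigma> 1) (\<tau> 3) + var_exp (\<sigma> 2) (\<tau> 2) + var_exp (\<sigma> 2) (\<tau> 3) +
          (var_exp (\<sigma> 3) (\<tau> 1) + var_exp (\<sigma> 3) (\<tau> 1))) (\<sigma> i, \<tau> j) =
        Poly_Mapping.lookup (block_table (\<sigma> 3, \<tau> 1)) (\<sigma> i, \<tau> j)"
      using exhaust_3[of i] exhaust_3[of j]
      by (elim disjE) (simp_all add: lookup_add lookup_single when_def lookup_tables inj)
  qed
  then show "act \<sigma> \<tau> eta1 = (monomial (block_table (\<sigma> 3, \<tau> 1)) :: 'k poly33)"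
    
      unfolding eta1_def act_simps unfolding z_eq_monomial mult_single by (simp only: mult_1_left)
  show "act \<sigma> \<tau> eta2 = (monomial (cograph_table \<pi>) :: 'k poly33)" if \<pi>: "\<And>i. \<pi> (\<sigma> i) = \<tau> i"
  proof -
    have "var_exp (\<sigma> 1) (\<tau> 2) + var_exp (\<sigma> 1) (\<tau> 3) + var_exp (\<sigma> 2) (\<tau> 1) + var_exp (\<sigma> 2) (\<tau> 3) + var_exp (\<sigma> 3) (\<tau> 1) + var_exp (\<sigma> 3) (\<tau> 2) =
        cograph_table \<pi>"
    proof (rule eqI)
      fix i j
      show "Poly_Mapping.lookup (var_exp (\<sigma> 1) (\<tau> 2) + var_exp (\<sigma> 1) (\<tau> 3) + var_exp (\<sigma> 2) (\<tau> 1) + var_exp (\<sigma> 2) (\<tau> 3) +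
            var_exp (\<sigma> 3) (\<tau> 1) + var_exp (\<sigma> 3) (\<tau> 2)) (\<sigma> i, \<tau> j) =
          Poly_Mapping.lookup (cograph_table \<pi>) (\<sigma> i, \<tau> j)"
        using exhaust_3[of i] exhaust_3[of j]
        by (elim disjE) (simp_all add: lookup_add lookup_single when_def lookup_tables inj \<pi>)
    qed
    then show ?thesis 
      unfolding eta2_def act_simps unfolding z_eq_monomial mult_single by (simp only: mult_1_left)
  qed
  show "act \<sigma> \<tau> eta3 = (monomial (graph_table \<pi>) :: 'k poly33)" if \<pi>: "\<And>i. \<pi> (\<sigma> i) = \<tau> (next3 i)"
  proof -
    have "(var_exp (\<sigma> 1) (\<tau> 2) + var_exp (\<sigma> 1) (\<tau> 2)) + (var_exp (\<sigma> 2) (\<tau> 3) + var_exp (\<sigma> 2) (\<tau> 3)) + (var_exp (\<sigma> 3) (\<tau> 1) + var_exp (\<sigma> 3) (\<tau> 1)) =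
        graph_table \<pi>"
    proof (rule eqI)
      fix i j
      show "Poly_Mapping.lookup ((var_exp (\<sigma> 1) (\<tau> 2) + var_exp (\<sigma> 1) (\<tau> 2)) + (var_exp (\<sigma> 2) (\<tau> 3) + var_exp (\<sigma> 2) (\<tau> 3)) +
            (var_exp (\<sigma> 3) (\<tau> 1) + var_exp (\<sigma> 3) (\<tau> 1))) (\<sigma> i, \<tau> j) =
          Poly_Mapping.lookup (graph_table \<pi>) (\<sigma> i, \<tau> j)"
        using exhaust_3[of i] exhaust_3[of j]
        by (elim disjE) (simp_all add: lookup_add lookup_single when_def lookup_tables inj \<pi>)
    qed
    then show ?thesis 
      unfolding eta3_def act_simps unfolding z_eq_monomial mult_single by (simp only: mult_1_left)
  qed
qed

lemma bij_next3: "bij next3"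
  by (rule o_bij[of "next3 \<circ> next3"]) (simp_all add: fun_eq_iff next3_cycle)

lemma orbitI: "act \<sigma> \<tau> q = p \<Longrightarrow> bij \<sigma> \<Longrightarrow> bij \<tau> \<Longrightarrow> p \<in> orbit q"
  by (auto simp: orbit_def)

lemma orbit_eta1: "orbit eta1 = (monomial ` range block_table :: 'k::field poly33 set)"
proof (intro set_eqI iffI)
  fix p :: "'k poly33" assume "p \<in> orbit eta1"
  then obtain \<sigma> \<tau> where "p = act \<sigma> \<tau> eta1" "bij \<sigma>" "bij \<tau>" by (auto simp: orbit_def)
  then show "p \<in> monomial ` range block_table" by (simp add: act_eta(1))
next
  fix p :: "'k poly33" assume "p \<in> monomial ` range block_table"
  then obtain c d where p: "p = monomial (block_table (c, d))" by auto
  have "act (Transposition.transpose 3 c) (Transposition.transpose 1 d) eta1 = p"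
    unfolding p by (subst act_eta(1)) simp_all
  then show "p \<in> orbit eta1" by (rule orbitI) simp_all
qed

lemma orbit_eta2: "orbit eta2 = (monomial ` cograph_table ` {\<pi>. bij \<pi>} :: 'k::field poly33 set)"
proof (intro set_eqI iffI)
  fix p :: "'k poly33" assume "p \<in> orbit eta2"
  then obtain \<sigma> \<tau> where p: "p = act \<sigma> \<tau> eta2" and b: "bij \<sigma>" "bij \<tau>" by (auto simp: orbit_def)
  have "p = monomial (cograph_table (\<tau> \<circ> inv \<sigma>))"
    unfolding p by (rule act_eta(2)[OF b]) (simp add: b bij_is_inj)
  moreover have "bij (\<tau> \<circ> inv \<sigma>)" by (intro bij_comp bij_imp_bij_inv b)
  ultimately show "p \<in> monomial ` cograph_table ` {\<pi>. bij \<pi>}" by blast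
next
  fix p :: "'k poly33" assume "p \<in> monomial ` cograph_table ` {\<pi>. bij \<pi>}"
  then obtain \<pi> where p: "p = monomial (cograph_table \<pi>)" and b: "bij \<pi>" by auto
  have "act id \<pi> eta2 = p" unfolding p by (rule act_eta(2)) (simp_all add: b)
  then show "p \<in> orbit eta2" by (rule orbitI) (simp_all add: b)
qed

lemma orbit_eta3: "orbit eta3 = (monomial ` graph_table ` {\<pi>. bij \<pi>} :: 'k::field poly33 set)"
proof (intro set_eqI iffI)
  fix p :: "'k poly33" assume "p \<in> orbit eta3"
  then obtain \<sigma> \<tau> where p: "p = act \<sigma> \<tau> eta3" and b: "bij \<sigma>" "bij \<tau>" by (auto simp: orbit_def)
  have "p = monomial (graph_table (\<tau> \<circ> next3 \<circ> inv \<sigma>))"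
    unfolding p by (rule act_eta(3)[OF b]) (simp add: b bij_is_inj)
  moreover have "bij (\<tau> \<circ> next3 \<circ> inv \<sigma>)" by (intro bij_comp bij_imp_bij_inv b bij_next3)
  ultimately show "p \<in> monomial ` graph_table ` {\<pi>. bij \<pi>}" by blast
next
  fix p :: "'k poly33" assume "p \<in> monomial ` graph_table ` {\<pi>. bij \<pi>}"
  then obtain \<pi> where p: "p = monomial (graph_table \<pi>)" and b: "bij \<pi>" by auto
  have b': "bij (\<pi> \<circ> next3 \<circ> next3)" by (intro bij_comp b bij_next3)
  have "act id (\<pi> \<circ> next3 \<circ> next3) eta3 = p"
    unfolding p by (rule act_eta(3)) (simp_all add: b' next3_cycle)
  then show "p \<in> orbit eta3" by (rule orbitI) (simp_all only: b' bij_id)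
qed

lemma odd_part_tables:
  "odd_part (block_table (c, d)) = {(i, j). i \<noteq> c \<and> j \<noteq> d}"
  "odd_part (cograph_table \<pi>) = {(i, j). j \<noteq> \<pi> i}"
  "odd_part (graph_table \<pi>) = {}"
  by (auto simp: odd_part_def lookup_tables split: if_splits)

definition line_sums_2 :: "monom33 \<Rightarrow> bool" where
  "line_sums_2 t \<longleftrightarrow> (\<forall>i. row_sum t i = 2 \<and> col_sum t i = 2)"

lemma line_sums_block_table: "line_sums_2 (block_table x)"
proof -
  obtain c d where x: "x = (c, d)" by fastforce
  have "row_sum (block_table (c, d)) i = 2" for i
    using exhaust_3[of d] by (auto simp: row_sum_def lookup_tables sum_3)
  moreover have "col_sum (block_table (c, d)) j = 2" for j
    using exhaust_3[of c] by (auto simp: col_sum_def lookup_tables sum_3)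
  ultimately show ?thesis by (simp add: line_sums_2_def x)
qed

lemma line_sums_graph_tables:
  assumes "bij \<pi>"
  shows "line_sums_2 (cograph_table \<pi>)" "line_sums_2 (graph_table \<pi>)"
proof -
  have col: "(\<Sum>i\<in>UNIV. f (\<pi> i)) = (\<Sum>i\<in>UNIV. f i)" for f :: "3 \<Rightarrow> nat"
    by (rule sum.reindex_bij_betw[OF assms])
  have "row_sum (cograph_table \<pi>) i = 2 \<and> row_sum (graph_table \<pi>) i = 2" for i
    using exhaust_3[of "\<pi> i"] by (auto simp: row_sum_def lookup_tables sum_3)
  moreover have "col_sum (cograph_table \<pi>) j = 2 \<and> col_sum (graph_table \<pi>) j = 2" for j
    unfolding col_sum_def lookup_tables
      col[of "\<lambda>k. if j = k then 0 else 1"] col[of "\<lambda>k. if j = k then 2 else 0"]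
    using exhaust_3[of j] by (auto simp: sum_3)
  ultimately show "line_sums_2 (cograph_table \<pi>)" "line_sums_2 (graph_table \<pi>)"
    by (simp_all add: line_sums_2_def)
qed

definition even_sets :: "(3 \<times> 3) set set" where
  "even_sets = odd_part ` {t. \<forall>i. even (row_sum t i) \<and> even (col_sum t i)}"

lemma odd_part_in_even_sets: "line_sums_2 t \<Longrightarrow> odd_part t \<in> even_sets"
  by (auto simp: even_sets_def line_sums_2_def)

definition perm_tables :: "monom33 set" where
  "perm_tables = range block_table \<union> cograph_table ` {\<pi>. bij \<pi>}"

lemma inj_odd_part: "inj_on odd_part perm_tables"
proof -
  have block: "c = c' \<and> d = d'" if "odd_part (block_table (c, d)) = odd_part (block_table (c', d'))" for c d c' d'
  proof -
    have "(i \<noteq> c \<and> j \<noteq> d) = (i \<noteq> c' \<and> j \<noteq> d')" for i j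
      using that unfolding odd_part_tables by (auto simp: set_eq_iff)
    from this[of "next3 c" d'] this[of c' "next3 d"] this[of c "next3 d'"] this[of "next3 c'" d]
    show ?thesis using exhaust_3[of c] exhaust_3[of c'] exhaust_3[of d] exhaust_3[of d']
      by (elim disjE) simp_all
  qed
  have cograph: "\<pi> = \<pi>'" if "odd_part (cograph_table \<pi>) = odd_part (cograph_table \<pi>')" for \<pi> \<pi>'
  proof
    fix i have "(j \<noteq> \<pi> i) = (j \<noteq> \<pi>' i)" for j
      using that unfolding odd_part_tables by (auto simp: set_eq_iff)
    then show "\<pi> i = \<pi>' i" by metis
  qed
  have mixed: "odd_part (cograph_table \<pi>) \<noteq> odd_part (block_table (c, d))" for \<pi> c d
  proof
    assume "odd_part (cograph_table \<pi>) = odd_part (block_table (c, d))"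
    then have "(j \<noteq> \<pi> i) = (i \<noteq> c \<and> j \<noteq> d)" for i j
      unfolding odd_part_tables by (auto simp: set_eq_iff)
    from this[where i = c and j = "next3 (\<pi> c)"] show False using exhaust_3[of "\<pi> c"] by auto
  qed
  show ?thesis
  proof (rule inj_onI)
    fix s t assume s: "s \<in> perm_tables" and t: "t \<in> perm_tables" and e: "odd_part s = odd_part t"
    consider c d c' d' where "s = block_table (c, d)" "t = block_table (c', d')"
      | c d \<pi> where "s = block_table (c, d)" "t = cograph_table \<pi>"
      | c d \<pi> where "t = block_table (c, d)" "s = cograph_table \<pi>"
      | \<pi> \<pi>' where "s = cograph_table \<pi>" "t = cograph_table \<pi>'"
      using s t unfolding perm_tables_def by auto
    then show "s = t"
    proof cases
      case 1
      then show ?thesis using e block by blast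
    next
      case 2
      then show ?thesis using e mixed by metis
    next
      case 3
      then show ?thesis using e mixed by metis
    next
      case 4
      then show ?thesis using e cograph by blast
    qed
  qed
qed

text \<open>An even set either omits a row, and then the other two rows agree and miss one column, or it
  misses exactly one column in each row; parity of the columns makes the latter a permutation.\<close>

lemma odd_part_perm_tables: "odd_part ` perm_tables = even_sets - {{}}"
proof (intro set_eqI iffI)
  fix A assume "A \<in> odd_part ` perm_tables"
  then obtain t where t: "t \<in> perm_tables" "A = odd_part t" by blast
  have "line_sums_2 t"
    using t(1) line_sums_block_table line_sums_graph_tables(1) by (auto simp: perm_tables_def)
  moreover have "A \<noteq> {}"
  proof -
    have "(next3 c, next3 d) \<in> odd_part (block_table (c, d))" for c d
      using exhaust_3[of c] exhaust_3[of d] by (auto simp: odd_part_tables)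
    moreover have "(1, next3 (\<pi> 1)) \<in> odd_part (cograph_table \<pi>)" for \<pi>
      using exhaust_3[of "\<pi> 1"] by (auto simp: odd_part_tables)
    ultimately show ?thesis using t unfolding perm_tables_def by fastforce
  qed
  ultimately show "A \<in> even_sets - {{}}" using odd_part_in_even_sets t by simp
next
  fix A assume A: "A \<in> even_sets - {{}}"
  then obtain t where t: "A = odd_part t" "\<And>i. even (row_sum t i)" "\<And>i. even (col_sum t i)"
    by (auto simp: even_sets_def)
  define P where "P i j \<longleftrightarrow> (i, j) \<in> A" for i j
  have rows: "P i 3 \<longleftrightarrow> (P i 1 \<noteq> P i 2)" for i
    using t(2)[of i] by (auto simp: P_def t(1) odd_part_def row_sum_def sum_3)
  have cols: "P 3 j \<longleftrightarrow> (P 1 j \<noteq> P 2 j)" for j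
    using t(3)[of j] by (auto simp: P_def t(1) odd_part_def col_sum_def sum_3)
  have ne: "P 1 1 \<or> P 1 2 \<or> P 2 1 \<or> P 2 2"
  proof (rule ccontr)
    assume "\<not> ?thesis"
    then have "\<not> P i j" for i j
      using rows[of 1] rows[of 2] rows[of 3] cols[of 1] cols[of 2] cols[of 3] exhaust_3[of i] exhaust_3[of j]
      by (elim disjE) simp_all
    then show False using A by (auto simp: P_def)
  qed
  have cases: "(\<exists>c d. \<forall>i j. P i j = (i \<noteq> c \<and> j \<noteq> d)) \<or> (\<exists>\<pi>. inj \<pi> \<and> (\<forall>i j. P i j = (j \<noteq> \<pi> i)))"
  proof (cases "\<exists>c. \<forall>j. \<not> P c j")
    case True
    \<comment> \<open>the omitted row, and the column missed by the other rows\<close>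
    define c where "c = (if \<not> P 1 1 \<and> \<not> P 1 2 then 1 else if \<not> P 2 1 \<and> \<not> P 2 2 then 2 else 3 :: 3)"
    define d where "d = (if \<not> P 1 1 \<and> \<not> P 2 1 then 1 else if \<not> P 1 2 \<and> \<not> P 2 2 then 2 else 3 :: 3)"
    have "(\<forall>j. \<not> P 1 j) \<or> (\<forall>j. \<not> P 2 j) \<or> (\<forall>j. \<not> P 3 j)"
      using True by (metis exhaust_3)
    then have "\<forall>i j. P i j = (i \<noteq> c \<and> j \<noteq> d)"
      using ne rows[of 1] rows[of 2] rows[of 3] cols[of 1] cols[of 2] cols[of 3]
      unfolding c_def d_def forall_3
      by (cases "P 1 1"; cases "P 1 2"; cases "P 2 1"; cases "P 2 2") simp_all
    then show ?thesis by blast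
  next
    case False
    \<comment> \<open>the column missed by a row\<close>
    define \<pi> where "\<pi> i = (if \<not> P i 1 then 1 else if \<not> P i 2 then 2 else 3 :: 3)" for i
    have "inj \<pi> \<and> (\<forall>i j. P i j = (j \<noteq> \<pi> i))"
      using False rows[of 1] rows[of 2] rows[of 3] cols[of 1] cols[of 2] cols[of 3]
      unfolding inj_def \<pi>_def forall_3 not_ex not_all not_not
      by (cases "P 1 1"; cases "P 1 2"; cases "P 2 1"; cases "P 2 2") (simp_all add: forall_3)
    then show ?thesis by blast
  qed
  have "\<exists>t\<in>perm_tables. odd_part t = A"
    using cases
  proof (elim disjE exE conjE)
    fix c d assume "\<forall>i j. P i j = (i \<noteq> c \<and> j \<noteq> d)"
    then have "odd_part (block_table (c, d)) = A" by (auto simp: odd_part_tables P_def)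
    then show ?thesis by (auto simp: perm_tables_def)
  next
    fix \<pi> assume "inj \<pi>" "\<forall>i j. P i j = (j \<noteq> \<pi> i)"
    then have "odd_part (cograph_table \<pi>) = A" by (auto simp: odd_part_tables P_def)
    moreover have "bij \<pi>"
      using \<open>inj \<pi>\<close> finite_UNIV_inj_surj[OF finite] by (simp add: bij_def)
    ultimately show ?thesis by (auto simp: perm_tables_def)
  qed
  then show "A \<in> odd_part ` perm_tables" by blast
qed

section \<open>The polynomial modulo the Frobenius power of the ideal\<close>

text \<open>The table from the first two orbits with a given set of odd positions; for the empty set the
  choice within the third orbit is immaterial modulo the Frobenius power of the ideal.\<close>

definition even_rep :: "(3 \<times> 3) set \<Rightarrow> monom33" where
  "even_rep A = (if A = {} then graph_table id else inv_into perm_tables odd_part A)"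

lemma even_rep:
  assumes "A \<in> even_sets"
  shows "odd_part (even_rep A) = A" "line_sums_2 (even_rep A)"
proof -
  have "odd_part (even_rep A) = A \<and> line_sums_2 (even_rep A)"
  proof (cases "A = {}")
    case True
    then show ?thesis by (simp add: even_rep_def odd_part_tables line_sums_graph_tables)
  next
    case False
    then have A: "A \<in> odd_part ` perm_tables" using assms odd_part_perm_tables by simp
    have "line_sums_2 t" if "t \<in> perm_tables" for t
      using that line_sums_block_table line_sums_graph_tables(1) by (auto simp: perm_tables_def)
    then show ?thesis
      using inv_into_into[OF A] f_inv_into_f[OF A] False by (simp add: even_rep_def)
  qed
  then show "odd_part (even_rep A) = A" "line_sums_2 (even_rep A)" by simp_all
qed

lemma inj_monomial: "inj (monomial :: monom33 \<Rightarrow> 'k::field poly33)"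
  by (rule injI) (metis lookup_single_eq lookup_single_not_eq zero_neq_one)

lemma const_of_nat: "const (of_nat n) = of_nat n"
  by (induction n) simp_all

lemma of_nat_odd_char2:
  assumes "CHAR('k::field) = 2" "odd n"
  shows "of_nat n = (1 :: 'k)"
proof -
  have "of_nat 2 = (0::'k)" using of_nat_CHAR[where 'a = 'k] assms(1) by simp
  then have two: "(2::'k) = 0" by simp
  obtain m where "n = 2 * m + 1" using assms(2) by (rule oddE)
  then show ?thesis by (simp add: two)
qed

context
  fixes S :: "'k::field poly33 set"
  assumes char: "CHAR('k) = 2" and S: "S \<subseteq> orbit eta3" "odd (card S)"
begin

lemma S_tables: "\<exists>X. X \<subseteq> graph_table ` {\<pi>. bij \<pi>} \<and> S = monomial ` X \<and> odd (card X) \<and> finite X"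
proof -
  obtain X where X: "X \<subseteq> graph_table ` {\<pi>. bij \<pi>}" "S = monomial ` X"
    using S(1) unfolding orbit_eta3 by (meson subset_image_iff)
  have "card S = card X" unfolding X(2) by (rule card_image) (metis inj_on_subset inj_monomial subset_UNIV)
  moreover have "finite X" using X(1) by (rule finite_subset) simp
  ultimately show ?thesis using X S(2) by auto
qed

lemma H0_expansion:
  assumes "S = monomial ` X"
  shows "H0 S = (\<Sum>t\<in>perm_tables. monomial t) + (\<Sum>t\<in>X. monomial t)"
proof -
  have inj: "inj_on (monomial :: _ \<Rightarrow> 'k poly33) Y" for Y using inj_monomial by (rule inj_on_subset) simp
  have disj: "range block_table \<inter> cograph_table ` {\<pi>. bij \<pi>} = {}"
  proof (intro equals0I)
    fix t assume "t \<in> range block_table \<inter> cograph_table ` {\<pi>. bij \<pi>}"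
    then obtain x \<pi> where "t = block_table x" and 2: "t = cograph_table \<pi>" by blast
    then obtain c d where 1: "t = block_table (c, d)" by (cases x) simp
    have "Poly_Mapping.lookup t (c, d) = 2" by (simp add: 1 lookup_tables)
    then show False by (simp add: 2 lookup_tables split: if_splits)
  qed
  show ?thesis
    unfolding H0_def orbit_eta1 orbit_eta2 assms perm_tables_def
    by (subst sum.union_disjoint) (simp_all add: disj sum.reindex[OF inj] image_image[symmetric] del: image_image)
qed

text \<open>In each class of even parities there is exactly one table from the first two orbits, except
  for the trivial parity, whose tables are those of the third orbit; as they are congruent, an odd
  number of them amounts to a single one.  So modulo the Frobenius power of the ideal the
  polynomial is the sum of one monomial for every even parity.\<close>

lemma H0_congr: "frob_congr (H0 S) (\<Sum>A\<in>even_sets. monomial (even_rep A))"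
proof -
  obtain X where X: "X \<subseteq> graph_table ` {\<pi>. bij \<pi>}" "S = monomial ` X" "odd (card X)" "finite X"
    using S_tables by blast
  have "frob_congr (\<Sum>t\<in>X. monomial t) (\<Sum>t\<in>X. monomial (graph_table id) :: 'k poly33)"
  proof (rule frob_congr_sum)
    fix t assume "t \<in> X"
    then obtain \<pi> where t: "t = graph_table \<pi>" "bij \<pi>" using X(1) by blast
    show "frob_congr (monomial t) (monomial (graph_table id) :: 'k poly33)"
      using line_sums_graph_tables(2)[OF t(2)] line_sums_graph_tables(2)[OF bij_id]
      by (intro frob_congr_monomials[OF char]) (simp_all add: t(1) odd_part_tables same_margins_def line_sums_2_def)
  qed
  also have "(\<Sum>t\<in>X. monomial (graph_table id) :: 'k poly33) = const (of_nat (card X)) * monomial (graph_table id)"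
    by (simp only: sum_constant const_of_nat)
  also have "\<dots> = monomial (even_rep {})"
    unfolding of_nat_odd_char2[OF char X(3)] by (simp add: even_rep_def)
  finally have 1: "frob_congr (\<Sum>t\<in>X. monomial t) (monomial (even_rep {}) :: 'k poly33)" .
  have "(\<Sum>A\<in>even_sets - {{}}. monomial (even_rep A)) = (\<Sum>t\<in>perm_tables. monomial (even_rep (odd_part t)) :: 'k poly33)"
    unfolding odd_part_perm_tables[symmetric] by (simp add: sum.reindex[OF inj_odd_part])
  also have "\<dots> = (\<Sum>t\<in>perm_tables. monomial t)"
  proof (rule sum.cong)
    fix t assume t: "t \<in> perm_tables"
    then have "odd_part t \<noteq> {}" using odd_part_perm_tables by blast
    then show "monomial (even_rep (odd_part t)) = (monomial t :: 'k poly33)"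
      using t by (simp add: even_rep_def inv_into_f_f[OF inj_odd_part])
  qed simp
  finally have 2: "(\<Sum>A\<in>even_sets - {{}}. monomial (even_rep A)) = (\<Sum>t\<in>perm_tables. monomial t :: 'k poly33)" .
  have "{} \<in> even_sets"
    using odd_part_in_even_sets[OF line_sums_graph_tables(2)[OF bij_id]] by (simp add: odd_part_tables)
  moreover have "finite even_sets" by (rule finite_subset[of _ UNIV]) simp_all
  ultimately have "(\<Sum>A\<in>even_sets. monomial (even_rep A)) =
      (\<Sum>t\<in>perm_tables. monomial t) + (monomial (even_rep {}) :: 'k poly33)"
    by (simp add: sum.remove[of even_sets "{}"] 2 add.commute)
  then show ?thesis
    using 1 unfolding H0_expansion[OF X(2)] frob_congr_def by simp
qed

text \<open>Multiplication by \<open>z\<^sub>i\<^sub>j z\<^sub>k\<^sub>l\<close> and by \<open>z\<^sub>i\<^sub>l z\<^sub>k\<^sub>j\<close> translate the even parities into the same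
  coset, because the four positions together form an even set.\<close>

lemma even_sum_exchange:
  assumes "i \<noteq> k" "j \<noteq> l"
  shows "frob_congr ((\<Sum>A\<in>even_sets. monomial (even_rep A)) * (z i j * z k l))
           ((\<Sum>A\<in>even_sets. monomial (even_rep A)) * (z i l * z k j) :: 'k poly33)"
proof -
  define m m' where "m = var_exp i j + var_exp k l" and "m' = var_exp i l + var_exp k j"
  define flip where "flip A = {v. (v \<in> A) \<noteq> (v = (i, j) \<or> v = (k, l) \<or> v = (i, l) \<or> v = (k, j))}" for A
  have odd_add: "v \<in> odd_part (s + t) \<longleftrightarrow> (v \<in> odd_part s) \<noteq> (v \<in> odd_part t)" for v s t
    by (simp add: odd_part_def lookup_add)
  have odd_m: "v \<in> odd_part m \<longleftrightarrow> v = (i, j) \<or> v = (k, l)" "v \<in> odd_part m' \<longleftrightarrow> v = (i, l) \<or> v = (k, j)" for v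
    using assms by (auto simp: odd_part_def m_def m'_def lookup_add lookup_single when_def)
  have flip: "odd_part (t + m + m') = flip (odd_part t)" for t
    using assms by (auto simp: odd_add odd_m flip_def)
  have flip_even: "flip A \<in> even_sets" if A: "A \<in> even_sets" for A
  proof -
    obtain t where t1: "A = odd_part t" and t2: "\<forall>i. even (row_sum t i) \<and> even (col_sum t i)"
      using A unfolding even_sets_def by blast
    have "flip A = odd_part (t + m + m')" by (simp add: t1 flip)
    moreover have "even (row_sum (t + m + m') a)" "even (col_sum (t + m + m') a)" for a
      using t2 by (simp_all add: m_def m'_def)
    ultimately show ?thesis unfolding even_sets_def by blast
  qed
  have flip_flip: "flip (flip A) = A" for A by (auto simp: flip_def)
  have bij: "bij_betw flip even_sets even_sets"
    by (rule bij_betw_byWitness[where f' = flip]) (auto simp: flip_flip flip_even)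
  have "frob_congr (\<Sum>A\<in>even_sets. monomial (even_rep A + m)) (\<Sum>A\<in>even_sets. monomial (even_rep (flip A) + m') :: 'k poly33)"
  proof (rule frob_congr_sum, rule frob_congr_monomials[OF char])
    fix A assume A: "A \<in> even_sets"
    note r = even_rep[OF A] even_rep[OF flip_even[OF A]]
    show "odd_part (even_rep A + m) = odd_part (even_rep (flip A) + m')"
      using assms by (auto simp: odd_add odd_m r) (auto simp: flip_def)
    show "same_margins (even_rep A + m) (even_rep (flip A) + m')"
      using r(2,4) by (simp add: same_margins_def line_sums_2_def m_def m'_def)
  qed
  also have "(\<Sum>A\<in>even_sets. monomial (even_rep (flip A) + m')) = (\<Sum>A\<in>even_sets. monomial (even_rep A + m') :: 'k poly33)"
    by (rule sum.reindex_bij_betw[OF bij])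
  finally show ?thesis
    by (simp add: sum_distrib_right mult_single z_eq_monomial m_def m'_def)
qed

lemma H0_mult_cof_mem: "H0 S * cof x \<in> frob_ideal"
proof -
  let ?R = "\<Sum>A\<in>even_sets. monomial (even_rep A) :: 'k poly33"
  obtain a b where x: "x = (a, b)" by fastforce
  have "next3 a \<noteq> next3 (next3 a)" "next3 b \<noteq> next3 (next3 b)"
    using exhaust_3[of a] exhaust_3[of b] by auto
  from even_sum_exchange[OF this] have "?R * cof x \<in> frob_ideal"
    by (simp add: frob_congr_def cof_def x right_diff_distrib)
  then have "frob_congr (?R * cof x) 0" by (simp add: frob_congr_def)
  with frob_congr_mult[OF H0_congr] have "frob_congr (H0 S * cof x) 0" by (rule frob_congr_trans)
  then show ?thesis by (simp add: frob_congr_def)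
qed

text \<open>The sum of the coefficients at the squares with line sums two is a linear functional that
  vanishes on the Frobenius power of the ideal: the two terms of the square of a minor have the
  same line sums.  On the polynomial only the terms from \<open>S\<close> contribute, one each.\<close>

lemma H0_not_mem: "H0 S \<notin> frob_ideal"
proof
  assume H: "H0 S \<in> frob_ideal"
  define f :: "monom33 \<Rightarrow> 'k poly33" where "f t = (if odd_part t = {} \<and> line_sums_2 t then 1 else 0)" for t
  have double: "lin_ext f (p * monomial (m + m)) = lin_ext f (p * monomial (m' + m'))"
    if "same_margins m m'" for p m m'
  proof (induction p rule: poly_induct)
    case (single t c)
    have "odd_part (t + (m + m)) = odd_part (t + (m' + m'))"
      by (simp add: odd_part_def lookup_add)
    moreover have "line_sums_2 (t + (m + m)) = line_sums_2 (t + (m' + m'))"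
      using that by (simp add: line_sums_2_def same_margins_def)
    ultimately show ?case by (simp add: mult_single f_def)
  qed (simp_all add: distrib_right)
  have cof: "lin_ext f (c * (cof x)\<^sup>2) = 0" for c x
  proof -
    obtain a b where x: "x = (a, b)" by fastforce
    define m where "m = var_exp (next3 a) (next3 b) + var_exp (next3 (next3 a)) (next3 (next3 b))"
    define m' where "m' = var_exp (next3 a) (next3 (next3 b)) + var_exp (next3 (next3 a)) (next3 b)"
    have "cof x = (monomial m - monomial m' :: 'k poly33)"
      by (simp add: cof_def x z_eq_monomial mult_single m_def m'_def)
    then have "(cof x)\<^sup>2 = (monomial (m + m) + monomial (m' + m') :: 'k poly33)"
      by (simp only: char2_simps(4)[OF char] power2_add_char2[OF char])
        (simp add: power2_eq_square mult_single)
    moreover have "same_margins m m'" by (auto simp: same_margins_def m_def m'_def)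
    ultimately show ?thesis
      by (simp add: distrib_left double[of m m'] char2_simps(1)[OF char])
  qed
  obtain c where "H0 S = (\<Sum>x\<in>UNIV. c x * (cof x)\<^sup>2)"
    using H by (auto simp: frob_ideal_def)
  then have zero: "lin_ext f (H0 S) = 0" by (simp add: lin_ext_sum cof)
  obtain X where X: "X \<subseteq> graph_table ` {\<pi>. bij \<pi>}" "S = monomial ` X" "odd (card X)" "finite X"
    using S_tables by blast
  have "lin_ext f (\<Sum>t\<in>perm_tables. monomial t) = 0"
    unfolding lin_ext_sum
  proof (rule sum.neutral, rule ballI)
    fix t assume "t \<in> perm_tables"
    then have "odd_part t \<noteq> {}" using odd_part_perm_tables by blast
    then show "lin_ext f (monomial t) = 0" by (simp add: f_def)
  qed
  moreover have "lin_ext f (\<Sum>t\<in>X. monomial t) = (\<Sum>t\<in>X. 1)"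
    unfolding lin_ext_sum
  proof (rule sum.cong)
    fix t assume "t \<in> X"
    then obtain \<pi> where "t = graph_table \<pi>" "bij \<pi>" using X(1) by blast
    then show "lin_ext f (monomial t) = 1"
      by (simp add: f_def odd_part_tables line_sums_graph_tables)
  qed simp
  moreover have "(\<Sum>t\<in>X. 1 :: 'k poly33) = const (of_nat (card X))"
    by (simp only: sum_constant const_of_nat mult_1_right)
  ultimately have "lin_ext f (H0 S) = 1"
    unfolding H0_expansion[OF X(2)] lin_ext_simps(3) by (simp add: of_nat_odd_char2[OF char X(3)])
  then show False using zero by simp
qed

end

lemma homog_H0:
  assumes "S \<subseteq> orbit eta3"
  shows "homog 6 (H0 S)"
proof -
  have deg: "mdeg t = 6" if "line_sums_2 t" for t
  proof -
    have "mdeg t = (\<Sum>i\<in>UNIV. row_sum t i)" by (simp add: mdeg_def row_sum_def sum_pairs_3)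
    then show ?thesis using that by (simp add: line_sums_2_def)
  qed
  have "homog 6 (monomial t)" if "line_sums_2 t" for t using deg[OF that] by (simp add: homog_def)
  then have "homog 6 u" if "u \<in> orbit eta1 \<union> orbit eta2 \<union> orbit eta3" for u
    using that line_sums_block_table line_sums_graph_tables unfolding orbit_eta1 orbit_eta2 orbit_eta3 by auto
  then show ?thesis unfolding H0_def using assms
    by (intro homog_add homog_sum) auto
qed

section \<open>The chain map\<close>

text \<open>Up to a change of bases over the field, every resolution of the given shape is the
  Gulliksen--Negard complex; in particular that complex is exact.\<close>

lemma resolution_comparison:
  fixes d1 :: "'k::field poly33 ^ 9 ^ 1"
    and d2 :: "'k poly33 ^ 16 ^ 9"
    and d3 :: "'k poly33 ^ 9 ^ 16"
    and d4 :: "'k poly33 ^ 1 ^ 9"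
  assumes char: "CHAR('k) = 2"
    and res: "minimal_graded_free_resolution minors_ideal 2 3 4 6 d1 d2 d3 d4"
  shows "\<exists>A1 A2 A3 A4 B1 B2 B3 B4.
      B1 ** A1 = mat 1 \<and> A1 ** B1 = mat 1 \<and> B2 ** A2 = mat 1 \<and> A2 ** B2 = mat 1 \<and>
      B3 ** A3 = mat 1 \<and> A3 ** B3 = mat 1 \<and> B4 ** A4 = mat 1 \<and> A4 ** B4 = mat 1 \<and>
      d1 ** const_mat A1 = G1 \<and> d2 ** const_mat A2 = const_mat A1 ** G2 \<and> d3 ** const_mat A3 = const_mat A2 ** G3 \<and>
      d4 ** const_mat A4 = const_mat A3 ** G4"
proof -
  have gr: "graded_map 2 0 d1" "graded_map 3 2 d2" "graded_map 4 3 d3" "graded_map 6 4 d4"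
    and im: "range ((*v) d1) = {x. x $ 1 \<in> minors_ideal}"
    and ex: "exact_at d2 d1" "exact_at d3 d2" "exact_at d4 d3"
    using res by (simp_all add: minimal_graded_free_resolution_def)
  interpret R: module "(*) :: 'k poly33 \<Rightarrow> 'k poly33 \<Rightarrow> 'k poly33"
    by unfold_locales (simp_all add: algebra_simps)
  have cof_mem: "cof x \<in> (minors_ideal :: 'k poly33 set)" for x
  proof -
    obtain a b where x: "x = (a, b)" by fastforce
    have "next3 a \<noteq> next3 (next3 a)" "next3 b \<noteq> next3 (next3 b)"
      using exhaust_3[of a] exhaust_3[of b] by auto
    then have "cof x \<in> {z i j * z k l - z i l * z k j | i j k l. i \<noteq> k \<and> j \<noteq> l}"
      unfolding cof_def x prod.case by blast
    then show ?thesis unfolding minors_ideal_def ideal_gen_def by (rule R.span_base)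
  qed
  have rng1: "(const_mat (mat 1) ** G1) *v x \<in> range ((*v) d1)" for x :: "'k poly33 ^ 9"
  proof -
    have "(G1 *v x) $ 1 = (\<Sum>r\<in>UNIV. x $ r * cof (enum9 r))"
      by (simp add: matrix_vector_mult_def G1_def mult.commute)
    also have "\<dots> \<in> minors_ideal"
      unfolding minors_ideal_def ideal_gen_def
      by (intro R.span_sum R.span_scale) (use cof_mem in \<open>simp add: minors_ideal_def ideal_gen_def\<close>)
    finally show ?thesis by (simp add: im)
  qed
  obtain A1 B1 where 1: "B1 ** A1 = mat 1" "A1 ** B1 = mat 1" "d1 ** const_mat A1 = const_mat (mat 1) ** G1"
    using comparison_step[OF gr(1) graded_G1 matrix_mul_lid[of "mat 1"] rng1 const_inj_G1] by blast
  have rng: "(const_mat A ** E') *v x \<in> range ((*v) d')"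
    if "exact_at d' d" "d ** const_mat A = C ** E" "E ** E' = 0"
    for d' :: "'k poly33 ^ 'p ^ 'n" and d :: "'k poly33 ^ 'n ^ 'm" and A :: "'k ^ 'n ^ 'n"
      and C :: "'k poly33 ^ 'm ^ 'm" and E :: "'k poly33 ^ 'n ^ 'm" and E' :: "'k poly33 ^ 'q ^ 'n" and x
  proof -
    have "d *v ((const_mat A ** E') *v x) = (C ** (E ** E')) *v x"
      by (simp add: matrix_vector_mul_assoc matrix_mul_assoc that(2))
    then show ?thesis using that(1) unfolding that(3) exact_at_def by auto
  qed
  obtain A2 B2 where 2: "B2 ** A2 = mat 1" "A2 ** B2 = mat 1" "d2 ** const_mat A2 = const_mat A1 ** G2"
    using comparison_step[OF gr(2) graded_G2 1(1) rng[OF ex(1) 1(3) G1_G2[OF char]] const_inj_G2]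
    by blast
  obtain A3 B3 where 3: "B3 ** A3 = mat 1" "A3 ** B3 = mat 1" "d3 ** const_mat A3 = const_mat A2 ** G3"
    using comparison_step[OF gr(3) graded_G3 2(1) rng[OF ex(2) 2(3) G2_G3[OF char]] const_inj_G3]
    by blast
  obtain A4 B4 where 4: "B4 ** A4 = mat 1" "A4 ** B4 = mat 1" "d4 ** const_mat A4 = const_mat A3 ** G4"
    using comparison_step[OF gr(4) graded_G4 3(1) rng[OF ex(3) 3(3) G3_G4[OF char]] const_inj_G4]
    by blast
  have first: "d1 ** const_mat A1 = G1" using 1(3) by simp
  show ?thesis
    by (rule exI[of _ A1], rule exI[of _ A2], rule exI[of _ A3], rule exI[of _ A4],
        rule exI[of _ B1], rule exI[of _ B2], rule exI[of _ B3], rule exI[of _ B4])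
      (intro conjI 1(1,2) 2 3 4 first)
qed

definition scalar_matrix :: "'a \<Rightarrow> 'a ^ 1 ^ 1" where
  "scalar_matrix c = (\<chi> i j. c)"

lemma matrix_mult_zero: "A ** 0 = 0"
  by (simp add: matrix_matrix_mult_def vec_eq_iff)

lemma matrix_mult_1_1:
  fixes A :: "'a::comm_ring_1 ^ 1 ^ 'n"
  shows "A ** B = (\<chi> i j. A $ i $ 1 * B $ 1 $ j)"
  by (simp add: matrix_matrix_mult_def)

context
  fixes S :: "'k::field poly33 set"
  assumes char: "CHAR('k) = 2" and S: "S \<subseteq> orbit eta3" "odd (card S)"
    and ex: "exact_at (G2 :: 'k poly33 ^ 16 ^ 9) G1" "exact_at (G3 :: 'k poly33 ^ 9 ^ 16) G2"
      "exact_at (G4 :: 'k poly33 ^ 1 ^ 9) G3" and inj: "inj ((*v) (G4 :: 'k poly33 ^ 1 ^ 9))"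
begin

text \<open>As the polynomial maps the ideal into its Frobenius power, multiplication by it lifts to a map
  from the complex to its Frobenius power, which is exact by flatness.  Degrees force the last
  component to be a constant.\<close>

lemma lift_of_multiplication:
  "\<exists>X1 X2 X3 c. graded_map 8 4 X1 \<and> graded_map 9 6 X2 \<and> graded_map 10 8 X3 \<and>
     scalar_matrix (H0 S) ** G1 = frob_mat G1 ** X1 \<and> X1 ** G2 = frob_mat G2 ** X2 \<and>
     X2 ** G3 = frob_mat G3 ** X3 \<and> X3 ** G4 = frob_mat G4 ** scalar_matrix (const c :: 'k poly33)"
proof -
  note squares = square_G[OF char]
  note fex = exact_at_frob_mat[OF ex(1) squares(2) squares(1)] exact_at_frob_mat[OF ex(2) squares(3) squares(2)]
    exact_at_frob_mat[OF ex(3) squares(4) squares(3)]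
  have fgr: "graded_map (2 * a) (2 * b) (frob_mat A)" if "graded_map a b A" for a b and A :: "'k poly33 ^ 'c ^ 'r"
    unfolding graded_map_def
  proof (intro allI ballI)
    fix i j t assume "t \<in> Poly_Mapping.keys (frob_mat A $ i $ j)"
    then have "t \<in> Poly_Mapping.keys (A $ i $ j * A $ i $ j)" by (simp add: frob_mat_def power2_eq_square)
    then obtain u v where "t = u + v" "u \<in> Poly_Mapping.keys (A $ i $ j)" "v \<in> Poly_Mapping.keys (A $ i $ j)"
      using keys_mult by blast
    moreover have "mdeg w + b = a" if "w \<in> Poly_Mapping.keys (A $ i $ j)" for w
      using \<open>graded_map a b A\<close> that by (simp add: graded_map_def)
    ultimately have "mdeg u + b = a" "mdeg v + b = a" "mdeg t = mdeg u + mdeg v"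
      by (simp_all add: mdeg_add)
    then show "mdeg t + 2 * b = 2 * a" by simp
  qed
  note gF = fgr[OF graded_G1, simplified] fgr[OF graded_G2, simplified] fgr[OF graded_G3, simplified]
    fgr[OF graded_G4, simplified]
  have gH: "graded_map 6 0 (scalar_matrix (H0 S))"
    by (rule graded_map_homogI[of 6]) (simp_all add: scalar_matrix_def homog_H0[OF S(1)])
  have "(scalar_matrix (H0 S) ** G1) *v x \<in> range ((*v) (frob_mat G1 :: 'k poly33 ^ 9 ^ 1))" for x
  proof -
    have "H0 S * (\<Sum>w\<in>UNIV. x $ inv enum9 w * cof w) = (\<Sum>w\<in>UNIV. x $ inv enum9 w * (H0 S * cof w))"
      by (simp add: sum_distrib_left mult_ac)
    also have "\<dots> \<in> frob_ideal"
      by (intro frob_ideal_sum frob_ideal_mult H0_mult_cof_mem[OF char S])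
    finally obtain c where c: "H0 S * (\<Sum>w\<in>UNIV. x $ inv enum9 w * cof w) = (\<Sum>w\<in>UNIV. c w * (cof w)\<^sup>2)"
      by (auto simp: frob_ideal_def)
    have "((scalar_matrix (H0 S) ** G1) *v x) $ 1 = H0 S * (\<Sum>r\<in>UNIV. x $ inv enum9 (enum9 r) * cof (enum9 r))"
      using bij_enum9
      by (simp add: matrix_mult_1_1 matrix_vector_mult_def scalar_matrix_def G1_def sum_distrib_left mult_ac bij_def)
    also have "\<dots> = (\<Sum>r\<in>UNIV. c (enum9 r) * (cof (enum9 r))\<^sup>2)"
      by (simp only: sum_enum9[where f = "\<lambda>w. x $ inv enum9 w * cof w"] c sum_enum9[where f = "\<lambda>w. c w * (cof w)\<^sup>2"])
    also have "\<dots> = (frob_mat G1 *v (\<chi> r. c (enum9 r))) $ 1"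
      by (simp add: matrix_vector_mult_def frob_mat_def G1_def mult.commute)
    finally have "(scalar_matrix (H0 S) ** G1) *v x = frob_mat G1 *v (\<chi> r. c (enum9 r))"
      by (simp add: vec_eq_iff)
    then show ?thesis by blast
  qed
  then obtain X1 where X1: "graded_map 8 4 X1" "scalar_matrix (H0 S) ** G1 = frob_mat G1 ** X1"
    using graded_factor[OF gF(1) graded_map_mult[OF gH graded_map_shift[OF graded_G1, of 6 8], simplified]] by auto
  have "frob_mat G1 ** (X1 ** G2) = scalar_matrix (H0 S) ** (G1 ** G2)"
    by (simp only: matrix_mul_assoc X1(2)[symmetric])
  also have "\<dots> = 0" by (simp only: G1_G2[OF char] matrix_mult_zero)
  finally have "frob_mat G1 ** (X1 ** G2) = 0" .
  then obtain X2 where X2: "graded_map 9 6 X2" "X1 ** G2 = frob_mat G2 ** X2"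
    using graded_lift[OF fex(1) gF(2) graded_map_mult[OF X1(1) graded_map_shift[OF graded_G2, of 8 9], simplified]] by auto
  have "frob_mat G2 ** (X2 ** G3) = X1 ** (G2 ** G3)"
    by (simp only: matrix_mul_assoc X2(2)[symmetric])
  also have "\<dots> = 0" by (simp only: G2_G3[OF char] matrix_mult_zero)
  finally have "frob_mat G2 ** (X2 ** G3) = 0" .
  then obtain X3 where X3: "graded_map 10 8 X3" "X2 ** G3 = frob_mat G3 ** X3"
    using graded_lift[OF fex(2) gF(3) graded_map_mult[OF X2(1) graded_map_shift[OF graded_G3, of 9 10], simplified]] by auto
  have "frob_mat G3 ** (X3 ** G4) = X2 ** (G3 ** G4)"
    by (simp only: matrix_mul_assoc X3(2)[symmetric])
  also have "\<dots> = 0" by (simp only: G3_G4[OF char] matrix_mult_zero)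
  finally have "frob_mat G3 ** (X3 ** G4) = 0" .
  then obtain X4 where X4: "graded_map 12 12 X4" "X3 ** G4 = frob_mat G4 ** X4"
    using graded_lift[OF fex(3) gF(4) graded_map_mult[OF X3(1) graded_map_shift[OF graded_G4, of 10 12], simplified]] by auto
  obtain M where "X4 = const_mat M" using graded_map_eq_const_mat[OF X4(1)] by blast
  then have "X4 = scalar_matrix (const (M $ 1 $ 1))" by (simp add: const_mat_def scalar_matrix_def vec_eq_iff)
  then show ?thesis using X1 X2 X3 X4(2) by blast
qed

text \<open>Transposing the lift and using the self-duality of the complex gives a chain map in the other
  direction, with the two ends interchanged.\<close>

lemma dual_chain_map:
  "\<exists>Y1 Y2 Y3 c. graded_map 4 2 Y1 \<and> graded_map 6 3 Y2 \<and> graded_map 8 4 Y3 \<and>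
     chain_map (frob_mat G1) (frob_mat G2) (frob_mat G3) (frob_mat G4) G1 G2 G3 G4
       (scalar_matrix (const c)) Y1 Y2 Y3 (scalar_matrix (H0 S :: 'k poly33))"
proof -
  obtain X1 X2 X3 c where gX: "graded_map 8 4 X1" "graded_map 9 6 X2" "graded_map 10 8 X3"
    and X: "scalar_matrix (H0 S) ** G1 = frob_mat G1 ** X1" "X1 ** G2 = frob_mat G2 ** X2"
     "X2 ** G3 = frob_mat G3 ** X3" "X3 ** G4 = frob_mat G4 ** scalar_matrix (const c :: 'k poly33)"
    using lift_of_multiplication by blast
  note T = X[THEN arg_cong[where f = transpose], unfolded matrix_transpose_mul]
  let ?P = "pairing :: 'k poly33 ^ 16 ^ 16"
  have t1: "transpose (scalar_matrix p) = scalar_matrix p" for p :: "'k poly33" by (simp add: scalar_matrix_def transpose_def vec_eq_iff)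
  have G2: "transpose G2 = ?P ** G3"
    by (simp only: G3_def matrix_mul_assoc pairing_pairing matrix_mul_lid)
  have G3: "transpose G3 = G2 ** ?P"
    by (simp only: G3_def matrix_transpose_mul transpose_transpose transpose_pairing)
  have G4: "transpose G4 = (G1 :: 'k poly33 ^ 9 ^ 1)" by (simp only: G4_def transpose_transpose)
  note frob = frob_mat_transpose[symmetric] frob_mat_mult[OF char] frob_mat_pairing
  have F1: "transpose (frob_mat G1) = frob_mat (G4 :: 'k poly33 ^ 1 ^ 9)"
    and F2: "transpose (frob_mat G2) = ?P ** frob_mat G3"
    and F3: "transpose (frob_mat G3) = frob_mat G2 ** ?P"
    and F4: "transpose (frob_mat G4) = frob_mat (G1 :: 'k poly33 ^ 9 ^ 1)"
    by (simp_all only: frob G2 G3 G4_def transpose_transpose)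
  define Y2 where "Y2 = ?P ** transpose X2 ** ?P"
  have "transpose X1 ** frob_mat G4 = G4 ** scalar_matrix (H0 S)"
    using T(1) by (simp only: F1 t1 G4_def)
  moreover have "Y2 ** frob_mat G3 = G3 ** transpose X1"
  proof -
    have "Y2 ** frob_mat G3 = ?P ** (transpose X2 ** transpose (frob_mat G2))"
      by (simp only: Y2_def F2 matrix_mul_assoc)
    also have "\<dots> = (?P ** ?P) ** G3 ** transpose X1"
      by (simp only: T(2)[symmetric] G2 matrix_mul_assoc)
    finally show ?thesis by (simp only: pairing_pairing matrix_mul_lid)
  qed
  moreover have "transpose X3 ** frob_mat G2 = G2 ** Y2"
  proof -
    have "transpose X3 ** frob_mat G2 = transpose X3 ** (frob_mat G2 ** (?P ** ?P))"
      by (simp only: pairing_pairing matrix_mul_rid)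
    also have "\<dots> = transpose X3 ** transpose (frob_mat G3) ** ?P"
      by (simp only: F3 matrix_mul_assoc)
    also have "\<dots> = G2 ** Y2"
      by (simp only: T(3)[symmetric] G3 Y2_def matrix_mul_assoc)
    finally show ?thesis .
  qed
  moreover have "scalar_matrix (const c) ** frob_mat G1 = G1 ** transpose X3"
    using T(4) by (simp only: F4 t1 G4)
  moreover have "graded_map 4 2 (transpose X3)" "graded_map 8 4 (transpose X1)"
    using graded_map_shift[OF gX(3), of 2 4] graded_map_shift[OF gX(1), of 4 8]
    by (simp_all add: graded_map_transpose)
  moreover have "graded_map 6 3 Y2"
  proof -
    have "graded_map 6 3 (transpose X2)" using graded_map_shift[OF gX(2), of 3 6] by (simp add: graded_map_transpose)
    then show ?thesis unfolding Y2_def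
      by (intro graded_map_mult[OF graded_map_mult[OF graded_pairing] graded_pairing])
  qed
  ultimately show ?thesis unfolding chain_map_def by blast
qed

text \<open>A chain map into an exact complex that vanishes at the end of the augmentation is
  null-homotopic, so its other end component has entries in the ideal generated by the last
  differential of the source, here the Frobenius power of the ideal of minors.\<close>

lemma dual_constant_nonzero:
  fixes Y1 Y2 Y3
  assumes ch: "chain_map (frob_mat G1) (frob_mat G2) (frob_mat G3) (frob_mat G4) G1 G2 G3 G4
       (scalar_matrix (const c)) Y1 Y2 Y3 (scalar_matrix (H0 S :: 'k poly33))"
  shows "c \<noteq> 0"
proof
  assume c: "c = 0"
  have lift: "\<exists>X. C = A ** X" if "exact_at A B" "B ** C = 0"
    for A :: "'k poly33 ^ 'p ^ 'n" and B :: "'k poly33 ^ 'n ^ 'm" and C :: "'k poly33 ^ 'q ^ 'n"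
  proof -
    have "\<exists>y. A *v y = column j C" for j
    proof -
      have "B *v column j C = column j (B ** C)"
        by (simp add: matrix_vector_mult_def column_def matrix_matrix_mult_def vec_eq_iff)
      also have "\<dots> = 0" unfolding that(2) by (simp add: column_def vec_eq_iff)
      finally have "column j C \<in> range ((*v) A)" using that(1) by (simp add: exact_at_def)
      then show ?thesis by (metis rangeE)
    qed
    then obtain y where y: "\<And>j. A *v y j = column j C" by metis
    have "C = A ** (\<chi> i j. y j $ i)"
      using y by (simp add: vec_eq_iff matrix_matrix_mult_def matrix_vector_mult_def column_def)
    then show ?thesis ..
  qed
  have diff: "A ** (B - C) = A ** B - A ** C" "(D - E) ** F = D ** F - E ** F"
    for A :: "'k poly33 ^ 'p ^ 'n" and B C :: "'k poly33 ^ 'q ^ 'p" and D E :: "'k poly33 ^ 'p ^ 'n"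
      and F :: "'k poly33 ^ 'q ^ 'p"
    by (simp_all add: matrix_matrix_mult_def vec_eq_iff algebra_simps sum_subtractf)
  have Y: "scalar_matrix (const c) ** frob_mat G1 = G1 ** Y1" "Y1 ** frob_mat G2 = G2 ** Y2"
    "Y2 ** frob_mat G3 = G3 ** Y3" "Y3 ** frob_mat G4 = G4 ** scalar_matrix (H0 S)"
    using ch by (simp_all add: chain_map_def)
  have zero: "frob_mat G2 ** frob_mat G3 = (0 :: 'k poly33 ^ 9 ^ 9)" "frob_mat G3 ** frob_mat G4 = (0 :: 'k poly33 ^ 1 ^ 16)"
    by (simp_all add: G2_G3[OF char] G3_G4[OF char] flip: frob_mat_mult[OF char])
      (simp_all add: frob_mat_def vec_eq_iff)
  have "G1 ** Y1 = 0" unfolding Y(1)[symmetric] c by (simp add: scalar_matrix_def matrix_matrix_mult_def vec_eq_iff)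
  then obtain h1 where h1: "Y1 = G2 ** h1" using lift[OF ex(1)] by blast
  have "G2 ** (Y2 - h1 ** frob_mat G2) = 0"
    by (simp add: diff matrix_mul_assoc flip: h1) (simp add: Y(2))
  then obtain h2 where h2: "Y2 - h1 ** frob_mat G2 = G3 ** h2" using lift[OF ex(2)] by blast
  have "G3 ** (Y3 - h2 ** frob_mat G3) = Y2 ** frob_mat G3 - (G3 ** h2) ** frob_mat G3"
    by (simp add: diff matrix_mul_assoc Y(3))
  also have "\<dots> = h1 ** (frob_mat G2 ** frob_mat G3)"
    unfolding h2[symmetric] by (simp add: diff matrix_mul_assoc)
  finally have "G3 ** (Y3 - h2 ** frob_mat G3) = 0" by (simp add: zero matrix_mult_zero)
  then obtain h3 where h3: "Y3 - h2 ** frob_mat G3 = G4 ** h3" using lift[OF ex(3)] by blast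
  have "G4 ** (scalar_matrix (H0 S) - h3 ** frob_mat G4) = Y3 ** frob_mat G4 - (G4 ** h3) ** frob_mat G4"
    by (simp add: diff matrix_mul_assoc Y(4))
  also have "\<dots> = h2 ** (frob_mat G3 ** frob_mat G4)"
    unfolding h3[symmetric] by (simp add: diff matrix_mul_assoc)
  finally have 0: "G4 ** (scalar_matrix (H0 S) - h3 ** frob_mat G4) = 0" by (simp add: zero matrix_mult_zero)
  have "scalar_matrix (H0 S) - h3 ** frob_mat G4 = 0"
  proof -
    have "G4 *v ((scalar_matrix (H0 S) - h3 ** frob_mat G4) *v x) = G4 *v 0" for x
      by (simp only: matrix_vector_mul_assoc 0 matrix_vector_mult_0 matrix_vector_mult_0_right)
    then have "(scalar_matrix (H0 S) - h3 ** frob_mat G4) *v x = 0" for x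
      using inj by (simp only: inj_eq)
    then show ?thesis by (simp add: matrix_eq)
  qed
  then have "scalar_matrix (H0 S) $ 1 $ 1 = (h3 ** frob_mat G4) $ 1 $ 1" by simp
  then have "H0 S = (\<Sum>r\<in>UNIV. h3 $ 1 $ r * (cof (enum9 r))\<^sup>2)"
    by (simp add: scalar_matrix_def matrix_matrix_mult_def frob_mat_def G4_def G1_def transpose_def)
  also have "\<dots> \<in> frob_ideal" by (intro frob_ideal_sum frob_ideal_mult frob_ideal_cof)
  finally show False using H0_not_mem[OF char S] by simp
qed

end

lemma is_basis_const:
  assumes "c \<noteq> 0"
  shows "is_basis {\<chi> i. const c :: 'k::field poly33 ^ 1}"
proof -
  interpret V: module "(*s) :: 'k poly33 \<Rightarrow> 'k poly33 ^ 1 \<Rightarrow> 'k poly33 ^ 1"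
    by unfold_locales (simp_all add: vec_eq_iff algebra_simps)
  let ?b = "\<chi> i. const c :: 'k poly33 ^ 1"
  have unit: "const (inverse c) * const c = (1 :: 'k poly33)"
    using assms by (simp flip: const_simps(4))
  have "V.independent {?b}"
  proof
    assume "V.dependent {?b}"
    then have "\<exists>f. (\<exists>v\<in>{?b}. f v \<noteq> 0) \<and> (\<Sum>v\<in>{?b}. f v *s v) = 0"
      by (subst (asm) V.dependent_finite) simp_all
    then obtain f where "f ?b *s ?b = 0" "f ?b \<noteq> 0" by auto
    then obtain u where "u *s ?b = 0" "u \<noteq> 0" by blast
    have u: "u * const c = 0" using \<open>u *s ?b = 0\<close> by (simp add: vec_eq_iff)
    have "u = u * (const (inverse c) * const c)" by (simp only: unit mult_1_right)
    also have "\<dots> = const (inverse c) * (u * const c)" by (simp only: mult_ac)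
    finally show False using u \<open>u \<noteq> 0\<close> by simp
  qed
  moreover have "x \<in> V.span {?b}" for x
  proof -
    have eq: "(x $ 1 * const (inverse c)) *s ?b = x" by (simp add: vec_eq_iff mult.assoc unit)
    have "(x $ 1 * const (inverse c)) *s ?b \<in> V.span {?b}"
      by (intro V.span_scale V.span_base) simp
    then show ?thesis unfolding eq .
  qed
  ultimately show ?thesis unfolding is_basis_def by auto
qed

lemma frob_mat_const_mat: "frob_mat (const_mat B) = const_mat (frob_mat B)"
  by (simp add: frob_mat_def const_mat_def vec_eq_iff power2_eq_square)

lemma mat_commute:
  fixes M :: "'a::comm_ring_1 ^ 'n ^ 'm"
  shows "mat c ** M = M ** mat c"
proof -
  have "(\<Sum>k\<in>UNIV. mat c $ i $ k * M $ k $ j) = (\<Sum>k\<in>UNIV. if k = i then c * M $ i $ j else 0)" for i j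
    by (intro sum.cong) (auto simp: mat_def)
  moreover have "(\<Sum>k\<in>UNIV. M $ i $ k * mat c $ k $ j) = (\<Sum>k\<in>UNIV. if k = j then c * M $ i $ j else 0)" for i j
    by (intro sum.cong) (auto simp: mat_def)
  ultimately show ?thesis by (simp add: matrix_matrix_mult_def vec_eq_iff)
qed

text \<open>How a commuting square between Frobenius powers and the original maps changes with the bases:
  source bases change by the Frobenius powers of the base changes.\<close>

lemma transported_square:
  fixes d G :: "'k::field poly33 ^ 'n ^ 'm"
  assumes char: "CHAR('k) = 2" and d: "d ** A = A0 ** G" and inv: "A ** B = mat 1" "B0 ** A0 = mat 1"
    and squares: "Y0 ** frob_mat G = G ** Y"
  shows "(A0 ** Y0 ** frob_mat B0) ** frob_mat d = d ** (A ** Y ** frob_mat B)"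
proof -
  have "d ** (A ** B) = A0 ** G ** B" by (simp only: matrix_mul_assoc d)
  then have d': "d = A0 ** G ** B" by (simp only: inv matrix_mul_rid)
  have one: "frob_mat (mat 1) = (mat 1 :: 'k poly33 ^ 'm ^ 'm)"
    by (simp add: frob_mat_def mat_def vec_eq_iff)
  have "frob_mat B0 ** frob_mat d = frob_mat (B0 ** A0) ** frob_mat G ** frob_mat B"
    by (simp only: d' frob_mat_mult[OF char] matrix_mul_assoc)
  also have "\<dots> = frob_mat G ** frob_mat B" by (simp only: inv one matrix_mul_lid)
  finally have "(A0 ** Y0 ** frob_mat B0) ** frob_mat d = A0 ** (Y0 ** frob_mat G) ** frob_mat B"
    by (simp only: matrix_mul_assoc[symmetric])
  also have "\<dots> = (A0 ** G) ** Y ** frob_mat B" by (simp only: squares matrix_mul_assoc)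
  also have "\<dots> = d ** (A ** Y ** frob_mat B)" by (simp only: d[symmetric] matrix_mul_assoc)
  finally show ?thesis .
qed

theorem proposition7p4:
  fixes d1 :: "'k::field poly33 ^ 9 ^ 1"
    and d2 :: "'k poly33 ^ 16 ^ 9"
    and d3 :: "'k poly33 ^ 9 ^ 16"
    and d4 :: "'k poly33 ^ 1 ^ 9"
    and S :: "'k poly33 set"
  assumes "CHAR('k) = 2"
    and "minimal_graded_free_resolution minors_ideal 2 3 4 6 d1 d2 d3 d4"
    and "S \<subseteq> orbit eta3" and "odd (card S)"
  shows "\<exists>(b :: 'k poly33 ^ 1) \<Phi>0 \<Phi>1 \<Phi>2 \<Phi>3 \<Phi>4.
           is_basis {b} \<and>
           chain_map (frob_mat d1) (frob_mat d2) (frob_mat d3) (frob_mat d4) d1 d2 d3 d4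
             \<Phi>0 \<Phi>1 \<Phi>2 \<Phi>3 \<Phi>4 \<and>
           graded_map 0 0 \<Phi>0 \<and> graded_map 4 2 \<Phi>1 \<and> graded_map 6 3 \<Phi>2 \<and>
           graded_map 8 4 \<Phi>3 \<and> graded_map 12 6 \<Phi>4 \<and>
           \<Phi>0 = mat 1 \<and>
           \<Phi>4 *v frob_vec b = H0 S *s b"
proof -
  note char = assms(1) and res = assms(2) and S = assms(3,4)
  obtain A1 A2 A3 A4 B1 B2 B3 B4 where
    inv: "B1 ** A1 = mat 1" "A1 ** B1 = mat 1" "B2 ** A2 = mat 1" "A2 ** B2 = mat 1"
      "B3 ** A3 = mat 1" "A3 ** B3 = mat 1" "B4 ** A4 = mat 1" "A4 ** B4 = mat 1" and
    d: "d1 ** const_mat A1 = G1" "d2 ** const_mat A2 = const_mat A1 ** G2" "d3 ** const_mat A3 = const_mat A2 ** G3"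
      "d4 ** const_mat A4 = const_mat A3 ** G4"
    using resolution_comparison[OF char res] by blast
  note cinv = inv[THEN arg_cong[where f = const_mat], unfolded const_mat_mult const_mat_1]
  have res_ex: "exact_at d2 d1" "exact_at d3 d2" "exact_at d4 d3" "inj ((*v) d4)"
    using res by (simp_all add: minimal_graded_free_resolution_def)
  have d1': "d1 ** const_mat A1 = const_mat (mat 1) ** G1" by (simp only: d const_mat_1 matrix_mul_lid)
  have ex: "exact_at (G2 :: 'k poly33 ^ 16 ^ 9) G1"
    by (rule exact_at_transport[OF res_ex(1) d1' d(2) cinv(1) cinv(4) G1_G2[OF char]])
  have ex': "exact_at (G3 :: 'k poly33 ^ 9 ^ 16) G2"
    by (rule exact_at_transport[OF res_ex(2) d(2) d(3) cinv(3) cinv(6) G2_G3[OF char]])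
  have ex'': "exact_at (G4 :: 'k poly33 ^ 1 ^ 9) G3"
    by (rule exact_at_transport[OF res_ex(3) d(3) d(4) cinv(5) cinv(8) G3_G4[OF char]])
  have inj: "inj ((*v) (G4 :: 'k poly33 ^ 1 ^ 9))"
  proof (rule injI)
    fix x y :: "'k poly33 ^ 1" assume "G4 *v x = G4 *v y"
    then have "const_mat A3 *v (G4 *v x) = const_mat A3 *v (G4 *v y)" by (simp only:)
    then have "d4 *v (const_mat A4 *v x) = d4 *v (const_mat A4 *v y)"
      by (simp only: matrix_vector_mul_assoc d)
    then have "const_mat A4 *v x = const_mat A4 *v y" by (rule injD[OF res_ex(4)])
    then have "const_mat B4 *v (const_mat A4 *v x) = const_mat B4 *v (const_mat A4 *v y)" by (simp only:)
    then show "x = y" by (simp only: matrix_vector_mul_assoc cinv matrix_vector_mul_lid)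
  qed
  obtain Y1 Y2 Y3 c where gY: "graded_map 4 2 Y1" "graded_map 6 3 Y2" "graded_map 8 4 Y3"
    and Y: "chain_map (frob_mat G1) (frob_mat G2) (frob_mat G3) (frob_mat G4) G1 G2 G3 G4
       (scalar_matrix (const c)) Y1 Y2 Y3 (scalar_matrix (H0 S :: 'k poly33))"
    using dual_chain_map[OF char S ex ex' ex'' inj] by blast
  have c: "c \<noteq> 0" by (rule dual_constant_nonzero[OF char S ex ex' ex'' inj Y])
  \<comment> \<open>Division by \<open>c\<close> turns the component in degree zero into the identity.\<close>
  define C where "C = const (inverse c)"
  have Cc: "const c * C = 1" unfolding C_def using c by (simp flip: const_simps(4))
  have graded_C: "graded_map n n (mat C :: 'k poly33 ^ 'n ^ 'n)" for n
  proof -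
    have "mat C = (const_mat (mat (inverse c)) :: 'k poly33 ^ 'n ^ 'n)"
      by (simp add: C_def const_mat_def mat_def vec_eq_iff)
    then show ?thesis by (simp only: graded_map_const_mat)
  qed
  have scale: "(U ** mat C) ** frob_mat E = E ** (V ** mat C)" if "U ** frob_mat E = E ** V"
    for U :: "'k poly33 ^ 'm ^ 'm" and V :: "'k poly33 ^ 'n ^ 'n" and E :: "'k poly33 ^ 'n ^ 'm"
  proof -
    have "(U ** mat C) ** frob_mat E = U ** (mat C ** frob_mat E)" by (simp only: matrix_mul_assoc)
    also have "\<dots> = (U ** frob_mat E) ** mat C" by (simp only: mat_commute matrix_mul_assoc)
    finally show ?thesis by (simp only: that matrix_mul_assoc)
  qed
  note squares = Y[unfolded chain_map_def, THEN conjunct1, THEN scale]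
    Y[unfolded chain_map_def, THEN conjunct2, THEN conjunct1, THEN scale]
    Y[unfolded chain_map_def, THEN conjunct2, THEN conjunct2, THEN conjunct1, THEN scale]
    Y[unfolded chain_map_def, THEN conjunct2, THEN conjunct2, THEN conjunct2, THEN scale]
  define \<Phi>1 where "\<Phi>1 = const_mat A1 ** (Y1 ** mat C) ** frob_mat (const_mat B1)"
  define \<Phi>2 where "\<Phi>2 = const_mat A2 ** (Y2 ** mat C) ** frob_mat (const_mat B2)"
  define \<Phi>3 where "\<Phi>3 = const_mat A3 ** (Y3 ** mat C) ** frob_mat (const_mat B3)"
  define \<Phi>4 where "\<Phi>4 = const_mat A4 ** (scalar_matrix (H0 S) ** mat C) ** frob_mat (const_mat B4)"
  have one: "const_mat (mat 1) ** (scalar_matrix (const c) ** mat C) ** frob_mat (const_mat (mat 1)) = mat 1"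
  proof -
    have "scalar_matrix (const c) ** mat C = (mat 1 :: 'k poly33 ^ 1 ^ 1)"
      by (simp add: matrix_mult_1_1 scalar_matrix_def mat_def vec_eq_iff Cc)
    moreover have "frob_mat (mat 1) = (mat 1 :: 'k poly33 ^ 1 ^ 1)"
      by (simp add: frob_mat_def mat_def vec_eq_iff)
    ultimately show ?thesis by (simp only: const_mat_1 matrix_mul_lid)
  qed
  have id: "const_mat (mat 1) ** const_mat (mat 1) = (mat 1 :: 'k poly33 ^ 1 ^ 1)" by (simp only: const_mat_1 matrix_mul_lid)
  have chain: "chain_map (frob_mat d1) (frob_mat d2) (frob_mat d3) (frob_mat d4) d1 d2 d3 d4
      (mat 1) \<Phi>1 \<Phi>2 \<Phi>3 \<Phi>4"
    unfolding chain_map_def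
  proof (intro conjI)
    show "mat 1 ** frob_mat d1 = d1 ** \<Phi>1"
      using transported_square[OF char d1' cinv(2) id squares(1)] by (simp only: one \<Phi>1_def)
    show "\<Phi>1 ** frob_mat d2 = d2 ** \<Phi>2"
      unfolding \<Phi>1_def \<Phi>2_def by (rule transported_square[OF char d(2) cinv(4) cinv(1) squares(2)])
    show "\<Phi>2 ** frob_mat d3 = d3 ** \<Phi>3"
      unfolding \<Phi>2_def \<Phi>3_def by (rule transported_square[OF char d(3) cinv(6) cinv(3) squares(3)])
    show "\<Phi>3 ** frob_mat d4 = d4 ** \<Phi>4"
      unfolding \<Phi>3_def \<Phi>4_def by (rule transported_square[OF char d(4) cinv(8) cinv(5) squares(4)])
  qed
  have graded: "graded_map n m (const_mat A ** (U ** mat C) ** frob_mat (const_mat B))" if "graded_map n m U"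
    for n m and A B :: "'k ^ 'n ^ 'n" and U
    unfolding frob_mat_const_mat
    by (intro graded_map_mult[OF graded_map_mult[OF graded_map_const_mat graded_map_mult[OF that graded_C]] graded_map_const_mat])
  have gH: "graded_map 12 6 (scalar_matrix (H0 S))"
    by (rule graded_map_homogI[of 6]) (simp_all add: scalar_matrix_def homog_H0[OF S(1)])
  have gr: "graded_map 4 2 \<Phi>1" "graded_map 6 3 \<Phi>2" "graded_map 8 4 \<Phi>3" "graded_map 12 6 \<Phi>4"
    unfolding \<Phi>1_def \<Phi>2_def \<Phi>3_def \<Phi>4_def by (rule graded[OF gY(1)] graded[OF gY(2)] graded[OF gY(3)] graded[OF gH])+
  define a where "a = A4 $ 1 $ 1"
  define a' where "a' = B4 $ 1 $ 1"
  have aa: "a * a' = 1"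
    using arg_cong[OF inv(8), of "\<lambda>M. M $ 1 $ 1"]
    by (simp add: a_def a'_def matrix_matrix_mult_def mat_def)
  then have ac: "a * c \<noteq> 0" using c by auto
  \<comment> \<open>The image of the induced basis element involves the square of the scaling of \<open>b\<close>, so a
      scaling of \<open>b\<close> can absorb the constants coming from \<open>c\<close> and from the change of bases.\<close>
  define b where "b = (\<chi> i. const (a * c) :: 'k poly33 ^ 1)"
  have end_map: "\<Phi>4 *v frob_vec b = H0 S *s b"
  proof -
    have "a * inverse c * (a' * a')  * (a * c) * (a * c) = a * (a * a') * (a * a') * (inverse c * c) * c"
      by (simp only: mult_ac)
    also have "\<dots> = a * c" using c by (simp add: aa)
    finally have k: "a * inverse c * (a' * a')  * (a * c) * (a * c) = a * c" .
    have "(\<Phi>4 *v frob_vec b) $ 1 = const a * (H0 S * C) * (const a')\<^sup>2 * (const (a * c))\<^sup>2"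
      by (simp add: \<Phi>4_def matrix_vector_mult_def matrix_matrix_mult_def frob_vec_def b_def
          frob_mat_def const_mat_def scalar_matrix_def mat_def a_def a'_def)
    also have "\<dots> = H0 S * const (a * inverse c * (a' * a') * (a * c) * (a * c))"
      by (simp add: C_def power2_eq_square mult_ac)
    also have "\<dots> = H0 S * const (a * c)" by (simp only: k)
    finally show ?thesis by (simp add: vec_eq_iff b_def)
  qed
  have basis: "is_basis {b}" unfolding b_def by (rule is_basis_const[OF ac])
  have gr0: "graded_map 0 0 (mat 1 :: 'k poly33 ^ 1 ^ 1)"
    using graded_map_const_mat[of 0 "mat 1"] by (simp only: const_mat_1)
  show ?thesis
    by (rule exI[of _ b], rule exI[of _ "mat 1"], rule exI[of _ \<Phi>1], rule exI[of _ \<Phi>2],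
        rule exI[of _ \<Phi>3], rule exI[of _ \<Phi>4])
      (intro conjI basis chain gr0 gr refl end_map)
qed

end
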